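(* Let $\gamma_t\in\mathcal{M}$ be a variation of $\gamma=\gamma_0$ with rotational monodromy $A\in SU_2$. Then the monodromy angle function $\theta=\theta_\lambda$ of the associated family satisfies $$\tfrac{1}{\lambda^{2}}\,\dot\theta=\tfrac{1}{\lambda^2}\,d\theta_\gamma(\dot\gamma)=\sigma(Y,\dot\gamma).$$ In other words, $Y$ is the symplectic vector field for the Hamiltonian $\lambda^{-2}\theta$.
   Context: Let $M\cong\mathbb{R}$ be an oriented 1-manifold with a fixed translation $\tau\in\mathrm{Diff}(M)$, $M/\tau\cong S^1$, and let $x_0\in M$ be a base point; $I\subset M$ is the fundamental domain for $\tau$ from $x_0$ to $\tau(x_0)$. Identify the Lie algebra $(\mathbb{R}^3,\times)$ with $\mathfrak{su}_2$ so that the commutator is the cross product; $SU_2$ acts on $\mathbb{R}^3$ by conjugation. Fix $A\in SU_2$, $a\in\mathbb{R}^3$, and let $\mathcal{M}$ be the manifold of smooth immersions $\gamma\colon M\to\mathbb{R}^3$ with $\gamma\circ\tau=A\gamma A^{-1}+a$. Its tangent space at $\gamma$ consists of the $\xi\colon M\to\mathbb{R}^3$ with $\xi\circ\tau=A\xi A^{-1}$. Let $dx$ be the arclength 1-form of $\gamma$, $(\ )'$ the arclength derivative, $T=\gamma'$. The Marsden–Weinstein 2-form is $\sigma_\gamma(\xi,\eta)=\int_I\det(T,\xi,\eta)\,dx$; a vector field $Y_E$ on $\mathcal{M}$ is symplectic for a Hamiltonian $E$ if $\sigma(Y_E,-)=dE$. A dot denotes $\frac{d}{dt}|_{t=0}$.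 For real $\lambda$ let $F_\lambda\colon M\to SU_2$ solve $F_\lambda'=F_\lambda\,\lambda T$, $F_\lambda(x_0)=\mathbf{1}$. The associated family $\gamma_\lambda\colon M\to\mathbb{R}^3$ is given by $\gamma_\lambda'=F_\lambda TF_\lambda^{-1}$, $\gamma_\lambda(x_0)=\gamma(x_0)$; its rotation monodromy is conjugation by $\tilde A_\lambda=F_\lambda(\tau(x_0))A$, which is real analytic in $\lambda$. Choose a unit length real analytic map $\lambda\mapsto Y_\lambda(x_0)\in S^2\subset\mathbb{R}^3$ spanning the axis of $\tilde A_\lambda$, that is, $\mathbb{R}\,Y_\lambda(x_0)=\mathbb{R}(\tilde A_\lambda-\tfrac12\mathrm{tr}\tilde A_\lambda\mathbf{1})$. The monodromy angle $\theta_\lambda$ is the rotation angle of the monodromy: conjugation by $\tilde A_\lambda$ is the right-handed rotation by $\theta_\lambda$ about $Y_\lambda(x_0)$. It does not depend on the base point $x_0$, so that for each real $\lambda$ one obtains a (modulo $2\pi$) well defined function $\theta_\lambda\colon\mathcal{M}\to\mathbb{R}$. Along $\gamma$ put $Y=Y_\lambda=F_\lambda^{-1}Y_\lambda(x_0)F_\lambda$. Then $Y'+\lambda T\times Y=0$, and $Y_\lambda\to T$ as $\lambda\to\infty$. At $\lambda=\infty$ it has the expansion $Y=\sum_{k\ge0}Y_k\lambda^{-k}$, the generating loop of the hierarchy of vector fields $Y_k$ on $\mathcal{M}$ given by $Y_0=T$, $Y_{k+1}=T\times Y_k'-\frac12\sum_{i=1}^k(Y_i,Y_{k-i+1})T$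.
   Formalization: The axis Y must be chosen continuously in the curve, and dθ and the symplectic field property are claimed only for curves whose monodromy is not ±1 (there no axis is determined and dθ fails to exist in general); at other curves the formula is stated for variations with continuous axis. *)

theory Defs
  imports "HOL-Analysis.Analysis"
begin

section \<open>Smooth and real analytic maps\<close>

primrec Ck_on :: "nat \<Rightarrow> 'a::euclidean_space set \<Rightarrow> ('a \<Rightarrow> 'b::real_normed_vector) \<Rightarrow> bool" where
  "Ck_on 0 S f \<longleftrightarrow> continuous_on S f"
| "Ck_on (Suc k) S f \<longleftrightarrow> (\<forall>x\<in>S. f differentiable (at x)) \<and>
     (\<forall>v. Ck_on k S (\<lambda>x. frechet_derivative f (at x) v))"

text \<open>Only used for open sets \<open>S\<close>.\<close>

definition smooth_on :: "'a::euclidean_space set \<Rightarrow> ('a \<Rightarrow> 'b::real_normed_vector) \<Rightarrow> bool" where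
  "smooth_on S f \<longleftrightarrow> (\<forall>k. Ck_on k S f)"

definition real_analytic :: "(real \<Rightarrow> 'b::real_normed_vector) \<Rightarrow> bool" where
  "real_analytic f \<longleftrightarrow> (\<forall>l0. \<exists>c. \<exists>r>0. \<forall>l. \<bar>l - l0\<bar> < r \<longrightarrow>
     (\<lambda>n. (l - l0) ^ n *\<^sub>R c n) sums f l)"

section \<open>\<open>SU\<^sub>2\<close> and its adjoint action\<close>

definition adjoint_mat :: "complex^2^2 \<Rightarrow> complex^2^2" where
  "adjoint_mat B = (\<chi> i j. cnj (B $ j $ i))"

definition SU2 :: "(complex^2^2) set" where
  "SU2 = {B. B ** adjoint_mat B = mat 1 \<and> det B = 1}"

text \<open>The identification of \<open>\<real>\<^sup>3\<close> with trace-free skew-Hermitian matrices is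
  \<open>v \<mapsto> - (\<i>/2) (v\<^sub>1 \<sigma>\<^sub>1 + v\<^sub>2 \<sigma>\<^sub>2 + v\<^sub>3 \<sigma>\<^sub>3)\<close> with the Pauli matrices \<open>\<sigma>\<^sub>j\<close>. The factor
  \<open>1/2\<close> makes the commutator equal to the cross product, see \<open>su2_cross\<close> below.\<close>

definition su2 :: "real^3 \<Rightarrow> complex^2^2" where
  "su2 v = vector [vector [Complex 0 (- v$3 / 2), Complex (- v$2 / 2) (- v$1 / 2)],
                   vector [Complex (v$2 / 2) (- v$1 / 2), Complex 0 (v$3 / 2)]]"

lemma su2_cross: "su2 (cross3 v w) = su2 v ** su2 w - su2 w ** su2 v"
  by (simp add: vec_eq_iff forall_2 su2_def cross3_def matrix_matrix_mult_def sum_2)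
    (simp add: complex_eq_iff)

lemma inj_su2: "inj su2"
  unfolding inj_def vec_eq_iff forall_2 forall_3 su2_def by simp

lemma bij_betw_su2: "bij_betw su2 UNIV {X. adjoint_mat X = - X \<and> trace X = 0}"
proof -
  have "X \<in> range su2" if X: "adjoint_mat X = - X" "trace X = 0" for X
  proof -
    have "X$2$2 = - X$1$1" using X(2) by (simp add: trace_def sum_2 add_eq_0_iff)
    moreover have "\<And>i j. cnj (X$j$i) = - X$i$j"
      using X(1) by (simp add: vec_eq_iff adjoint_mat_def)
    then have "cnj (X$1$1) = - X$1$1" "X$2$1 = - cnj (X$1$2)"
      by (simp, metis add.inverse_inverse)
    ultimately have "X = su2 (vector [- 2 * Im (X$1$2), - 2 * Re (X$1$2), - 2 * Im (X$1$1)])"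
      by (simp add: vec_eq_iff forall_2 su2_def complex_eq_iff)
    then show ?thesis by blast
  qed
  moreover have "adjoint_mat (su2 v) = - su2 v" for v
    by (simp add: vec_eq_iff forall_2 su2_def adjoint_mat_def complex_eq_iff)
  moreover have "trace (su2 v) = 0" for v
    by (simp add: su2_def trace_def sum_2 complex_eq_iff)
  ultimately show ?thesis
    using inj_su2 unfolding bij_betw_def by blast
qed

definition Ad :: "complex^2^2 \<Rightarrow> real^3 \<Rightarrow> real^3" where
  "Ad B v = inv su2 (B ** su2 v ** matrix_inv B)"

text \<open>The right-handed rotation by \<open>\<phi>\<close> about the unit vector \<open>n\<close> (Rodrigues' formula).\<close>

definition rotation :: "real^3 \<Rightarrow> real \<Rightarrow> real^3 \<Rightarrow> real^3" where
  "rotation n \<phi> v = cos \<phi> *\<^sub>R v + sin \<phi> *\<^sub>R cross3 n v + ((1 - cos \<phi>) * (n \<bullet> v)) *\<^sub>R n"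

section \<open>Immersed curves with monodromy\<close>

text \<open>The oriented 1-manifold \<open>M\<close> is the real line, with a diffeomorphism \<open>\<tau>\<close> that moves every
  point in the positive direction. The fundamental domain from \<open>x0\<close> to \<open>\<tau> x0\<close> is the
  interval \<open>{x0..\<tau> x0}\<close>.\<close>

type_synonym curve = "real \<Rightarrow> real^3"

definition translation :: "(real \<Rightarrow> real) \<Rightarrow> bool" where
  "translation \<tau> \<longleftrightarrow> bij \<tau> \<and> smooth_on UNIV \<tau> \<and> smooth_on UNIV (inv \<tau>) \<and> (\<forall>x. x < \<tau> x)"

definition curves :: "(real \<Rightarrow> real) \<Rightarrow> complex^2^2 \<Rightarrow> real^3 \<Rightarrow> curve set" where
  "curves \<tau> A a = {\<gamma>. smooth_on UNIV \<gamma> \<and> (\<forall>x. vector_derivative \<gamma> (at x) \<noteq> 0) \<and>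
     (\<forall>x. \<gamma> (\<tau> x) = Ad A (\<gamma> x) + a)}"

definition tangent_space :: "(real \<Rightarrow> real) \<Rightarrow> complex^2^2 \<Rightarrow> curve set" where
  "tangent_space \<tau> A = {\<xi>. smooth_on UNIV \<xi> \<and> (\<forall>x. \<xi> (\<tau> x) = Ad A (\<xi> x))}"

definition speed :: "curve \<Rightarrow> real \<Rightarrow> real" where
  "speed \<gamma> x = norm (vector_derivative \<gamma> (at x))"

definition arc_derivative :: "curve \<Rightarrow> (real \<Rightarrow> 'b::real_normed_vector) \<Rightarrow> real \<Rightarrow> 'b" where
  "arc_derivative \<gamma> f x = vector_derivative f (at x) /\<^sub>R speed \<gamma> x"

definition unit_tangent :: "curve \<Rightarrow> real \<Rightarrow> real^3" where
  "unit_tangent \<gamma> = arc_derivative \<gamma> \<gamma>"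

text \<open>The Marsden--Weinstein form; the factor \<open>speed \<gamma> x\<close> is the density of the arclength form.\<close>

definition MW_form :: "(real \<Rightarrow> real) \<Rightarrow> real \<Rightarrow> curve \<Rightarrow> curve \<Rightarrow> curve \<Rightarrow> real" where
  "MW_form \<tau> x0 \<gamma> \<xi> \<eta> = integral {x0..\<tau> x0}
     (\<lambda>x. det (vector [unit_tangent \<gamma> x, \<xi> x, \<eta> x] :: real^3^3) * speed \<gamma> x)"

section \<open>Variations and differentials\<close>

definition variation ::
  "(real \<Rightarrow> real) \<Rightarrow> complex^2^2 \<Rightarrow> real^3 \<Rightarrow> curve \<Rightarrow> (real \<Rightarrow> curve) \<Rightarrow> bool" where
  "variation \<tau> A a \<gamma> g \<longleftrightarrow> g 0 = \<gamma> \<and>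
     (\<exists>\<epsilon>>0. smooth_on {p. \<bar>fst p\<bar> < \<epsilon>} (\<lambda>p. g (fst p) (snd p)) \<and>
            (\<forall>t. \<bar>t\<bar> < \<epsilon> \<longrightarrow> g t \<in> curves \<tau> A a))"

definition velocity :: "(real \<Rightarrow> curve) \<Rightarrow> curve" where
  "velocity g x = vector_derivative (\<lambda>t. g t x) (at 0)"

text \<open>A function \<open>f\<close> that is only well defined modulo \<open>p\<close> has derivative \<open>c\<close> at \<open>0\<close> if, near \<open>0\<close>,
  it differs by integer multiples of \<open>p\<close> from a function with derivative \<open>c\<close> at \<open>0\<close>.
  For \<open>p > 0\<close> the number \<open>c\<close> is unique.\<close>

definition has_derivative_mod :: "real \<Rightarrow> (real \<Rightarrow> real) \<Rightarrow> real \<Rightarrow> bool" where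
  "has_derivative_mod p f c \<longleftrightarrow> (\<exists>\<phi>. (\<phi> has_real_derivative c) (at 0) \<and>
     (\<forall>\<^sub>F t in nhds 0. \<exists>k::int. f t = \<phi> t + of_int k * p))"

text \<open>\<open>L\<close> is the differential at \<open>\<gamma>\<close> of the function \<open>E\<close> on \<open>curves \<tau> A a\<close>, \<open>E\<close> being well defined
  modulo \<open>p\<close>.\<close>

definition has_differential_mod ::
  "real \<Rightarrow> (real \<Rightarrow> real) \<Rightarrow> complex^2^2 \<Rightarrow> real^3 \<Rightarrow> (curve \<Rightarrow> real) \<Rightarrow> curve \<Rightarrow> (curve \<Rightarrow> real) \<Rightarrow> bool"
where
  "has_differential_mod p \<tau> A a E \<gamma> L \<longleftrightarrow>
     (\<forall>\<xi>\<in>tangent_space \<tau> A. \<forall>\<eta>\<in>tangent_space \<tau> A. \<forall>r s.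
        L (\<lambda>x. r *\<^sub>R \<xi> x + s *\<^sub>R \<eta> x) = r * L \<xi> + s * L \<eta>) \<and>
     (\<forall>g. variation \<tau> A a \<gamma> g \<longrightarrow> has_derivative_mod p (\<lambda>t. E (g t)) (L (velocity g)))"

text \<open>\<open>V\<close> is a symplectic vector field on \<open>U \<subseteq> curves \<tau> A a\<close> for the Hamiltonian \<open>E\<close>:
  \<open>\<sigma>(V, -) = dE\<close>.\<close>

definition symplectic_field_mod ::
  "real \<Rightarrow> (real \<Rightarrow> real) \<Rightarrow> real \<Rightarrow> complex^2^2 \<Rightarrow> real^3 \<Rightarrow> curve set \<Rightarrow>
   (curve \<Rightarrow> real) \<Rightarrow> (curve \<Rightarrow> curve) \<Rightarrow> bool"
where
  "symplectic_field_mod p \<tau> x0 A a U E V \<longleftrightarrow>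
     (\<forall>\<gamma>\<in>U. V \<gamma> \<in> tangent_space \<tau> A \<and>
        has_differential_mod p \<tau> A a E \<gamma> (MW_form \<tau> x0 \<gamma> (V \<gamma>)))"

section \<open>The associated family and its monodromy\<close>

definition is_frame :: "real \<Rightarrow> curve \<Rightarrow> real \<Rightarrow> (real \<Rightarrow> complex^2^2) \<Rightarrow> bool" where
  "is_frame x0 \<gamma> l F \<longleftrightarrow> F x0 = mat 1 \<and>
     (\<forall>x. F x \<in> SU2 \<and> F differentiable (at x) \<and>
          arc_derivative \<gamma> F x = F x ** su2 (l *\<^sub>R unit_tangent \<gamma> x))"

definition is_associated_curve :: "real \<Rightarrow> curve \<Rightarrow> (real \<Rightarrow> complex^2^2) \<Rightarrow> curve \<Rightarrow> bool" where
  "is_associated_curve x0 \<gamma> F \<delta> \<longleftrightarrow> \<delta> x0 = \<gamma> x0 \<and>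
     (\<forall>x. \<delta> differentiable (at x) \<and> arc_derivative \<gamma> \<delta> x = Ad (F x) (unit_tangent \<gamma> x))"

definition monodromy ::
  "(real \<Rightarrow> real) \<Rightarrow> real \<Rightarrow> complex^2^2 \<Rightarrow> (real \<Rightarrow> complex^2^2) \<Rightarrow> complex^2^2" where
  "monodromy \<tau> x0 A F = F (\<tau> x0) ** A"

text \<open>\<open>B\<close> is the family of monodromies. Where \<open>B l\<close> is \<open>mat 1\<close> or \<open>- mat 1\<close>, its trace-free part
  vanishes and determines no axis; there the value \<open>y l\<close> is fixed by analyticity.\<close>

definition axis_family :: "(real \<Rightarrow> complex^2^2) \<Rightarrow> (real \<Rightarrow> real^3) \<Rightarrow> bool" where
  "axis_family B y \<longleftrightarrow> real_analytic y \<and> (\<forall>l. norm (y l) = 1) \<and>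
     (\<forall>l. B l \<notin> {mat 1, - mat 1} \<longrightarrow> span {su2 (y l)} = span {B l - mat (trace (B l) / 2)})"

definition is_rotation_angle :: "complex^2^2 \<Rightarrow> real^3 \<Rightarrow> real \<Rightarrow> bool" where
  "is_rotation_angle B y \<phi> \<longleftrightarrow> (\<forall>v. Ad B v = rotation y \<phi> v)"

definition axis_field :: "(real \<Rightarrow> complex^2^2) \<Rightarrow> real^3 \<Rightarrow> curve" where
  "axis_field F y x = Ad (matrix_inv (F x)) y"

text \<open>The curves in \<open>curves \<tau> A a\<close> whose associated monodromy for the parameter in question determines
  an axis; \<open>F \<gamma>\<close> is the frame of \<open>\<gamma>\<close> for that parameter.\<close>

definition regular_curves ::
  "(real \<Rightarrow> real) \<Rightarrow> real \<Rightarrow> complex^2^2 \<Rightarrow> real^3 \<Rightarrow> (curve \<Rightarrow> real \<Rightarrow> complex^2^2) \<Rightarrow> curve set"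
where
  "regular_curves \<tau> x0 A a F =
     {\<gamma> \<in> curves \<tau> A a. monodromy \<tau> x0 A (F \<gamma>) \<notin> {mat 1, - mat 1}}"

section \<open>The rotation monodromy of the associated curves\<close>

lemma SU2_inv:
  assumes "B \<in> SU2"
  shows "B ** adjoint_mat B = mat 1" "adjoint_mat B ** B = mat 1" "matrix_inv B = adjoint_mat B"
proof -
  show 1: "B ** adjoint_mat B = mat 1" using assms by (simp add: SU2_def)
  then show 2: "adjoint_mat B ** B = mat 1" by (simp add: matrix_left_right_inverse)
  have "\<exists>B'. B ** B' = mat 1 \<and> B' ** B = mat 1" using 1 2 by blast
  then have *: "B ** matrix_inv B = mat 1 \<and> matrix_inv B ** B = mat 1"
    unfolding matrix_inv_def by (rule someI_ex)
  have "matrix_inv B = (adjoint_mat B ** B) ** matrix_inv B" by (simp add: 2)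
  also have "\<dots> = adjoint_mat B" using * by (simp add: matrix_mul_assoc[symmetric])
  finally show "matrix_inv B = adjoint_mat B" .
qed

lemma adjoint_mat_mult: "adjoint_mat (B ** C) = adjoint_mat C ** adjoint_mat B"
  by (simp add: vec_eq_iff adjoint_mat_def matrix_matrix_mult_def mult.commute)

lemma SU2_mult: assumes "B \<in> SU2" "C \<in> SU2" shows "B ** C \<in> SU2"
proof -
  have "(B ** C) ** (adjoint_mat C ** adjoint_mat B) = B ** (C ** adjoint_mat C) ** adjoint_mat B"
    by (simp add: matrix_mul_assoc)
  then show ?thesis
    using assms SU2_inv(1)[OF assms(1)] SU2_inv(1)[OF assms(2)] by (simp add: SU2_def adjoint_mat_mult det_mul)
qed

lemma su2_Ad: assumes "B \<in> SU2" shows "su2 (Ad B v) = B ** su2 v ** adjoint_mat B"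
proof -
  let ?X = "B ** su2 v ** adjoint_mat B"
  have v: "adjoint_mat (su2 v) = - su2 v" "trace (su2 v) = 0"
    using bij_betw_su2 by (auto simp: bij_betw_def)
  have aa: "adjoint_mat (adjoint_mat B) = B" by (simp add: adjoint_mat_def vec_eq_iff)
  have neg: "B ** (- su2 v) ** adjoint_mat B = - ?X"
    by (simp add: vec_eq_iff matrix_matrix_mult_def sum_negf)
  have "adjoint_mat ?X = B ** (adjoint_mat (su2 v)) ** adjoint_mat B"
    by (simp only: adjoint_mat_mult aa matrix_mul_assoc)
  then have "adjoint_mat ?X = - ?X" using v neg by simp
  moreover have "trace ?X = trace (adjoint_mat B ** (B ** su2 v))" by (rule trace_mul_sym)
  then have "trace ?X = 0" using v SU2_inv(2)[OF assms] by (simp add: matrix_mul_assoc)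
  ultimately have "?X \<in> range su2" using bij_betw_su2 by (auto simp: bij_betw_def)
  then show ?thesis using SU2_inv[OF assms] by (simp add: Ad_def f_inv_into_f)
qed

lemma linear_su2: "linear su2"
  by (rule linearI) (simp_all add: vec_eq_iff forall_2 su2_def complex_eq_iff field_simps)

lemma Ad_mult: assumes "B \<in> SU2" "C \<in> SU2" shows "Ad (B ** C) v = Ad B (Ad C v)"
proof (rule injD[OF inj_su2])
  show "su2 (Ad (B ** C) v) = su2 (Ad B (Ad C v))"
    by (simp add: su2_Ad assms SU2_mult adjoint_mat_mult matrix_mul_assoc)
qed

lemma bilinear_matmul: "bounded_bilinear ((**) :: complex^2^2 \<Rightarrow> complex^2^2 \<Rightarrow> complex^2^2)"
  by (intro bilinear_conv_bounded_bilinear[THEN iffD1])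
    (auto simp: bilinear_def matrix_matrix_mult_def vec_eq_iff sum_2 intro!: linearI,
     auto simp: algebra_simps scaleR_conv_of_real)

lemma linear_Ad: assumes "B \<in> SU2" shows "bounded_linear (Ad B)"
proof -
  interpret bounded_bilinear "(**) :: complex^2^2 \<Rightarrow> complex^2^2 \<Rightarrow> complex^2^2" by (rule bilinear_matmul)
  have "linear (Ad B)"
    by (rule linearI; rule injD[OF inj_su2])
      (simp_all add: su2_Ad assms linear_add[OF linear_su2] linear_scale[OF linear_su2]
        add_left add_right scaleR_left scaleR_right)
  then show ?thesis by (simp add: linear_conv_bounded_linear)
qed

lemma det_su2: "det (su2 v) = of_real ((norm v)\<^sup>2 / 4)"
proof -
  have "(norm v)\<^sup>2 = v$1 * v$1 + v$2 * v$2 + v$3 * v$3"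
    by (simp add: power2_norm_eq_inner inner_vec_def sum_3)
  then show ?thesis by (simp add: det_2 su2_def complex_eq_iff field_simps)
qed

lemma norm_Ad: assumes "B \<in> SU2" shows "norm (Ad B v) = norm v"
proof -
  have "det (adjoint_mat B) = 1"
    using arg_cong[OF SU2_inv(1)[OF assms], of det] assms by (simp add: det_mul SU2_def)
  then have "det (su2 (Ad B v)) = det (su2 v)"
    using assms by (simp add: su2_Ad det_mul SU2_def)
  then have "(norm (Ad B v))\<^sup>2 = (norm v)\<^sup>2" unfolding det_su2 of_real_eq_iff by simp
  then show ?thesis by simp
qed

lemma bounded_linear_adjoint_mat: "bounded_linear adjoint_mat"
  by (rule linear_conv_bounded_linear[THEN iffD1], rule linearI)
    (auto simp: adjoint_mat_def vec_eq_iff)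

lemma translation_deriv:
  assumes "translation \<tau>"
  obtains d where "(\<tau> has_real_derivative d) (at x)" "d \<ge> 0"
proof -
  have diff: "\<tau> differentiable (at x)" for x
  proof -
    have "Ck_on 1 UNIV \<tau>" using assms by (simp add: translation_def smooth_on_def del: Ck_on.simps)
    then show ?thesis by simp
  qed
  then obtain d where d: "(\<tau> has_real_derivative d) (at x)"
    using real_differentiable_def by blast
  have "continuous_on UNIV \<tau>"
    using diff by (simp add: continuous_on_eq_continuous_at differentiable_imp_continuous_within)
  then have "strict_mono_on UNIV \<tau> \<or> strict_antimono_on UNIV \<tau>"
    using assms injective_eq_monotone_map[of UNIV \<tau>] by (simp add: translation_def bij_def)
  moreover have "\<not> strict_antimono_on UNIV \<tau>"
  proof
    assume "strict_antimono_on UNIV \<tau>"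
    then have "\<tau> (\<tau> 0) < \<tau> 0" using assms by (simp add: monotone_on_def translation_def)
    then show False using assms unfolding translation_def by (metis less_asym)
  qed
  ultimately have "mono_on UNIV \<tau>" by (simp add: strict_mono_on_imp_mono_on)
  then have "d \<ge> 0" using mono_on_imp_deriv_nonneg[OF _ d] by simp
  with d that show ?thesis by blast
qed

lemma has_vector_derivative_arc_derivative:
  assumes "f differentiable (at x)" "speed \<gamma> x > 0"
  shows "(f has_vector_derivative speed \<gamma> x *\<^sub>R arc_derivative \<gamma> f x) (at x)"
  using assms by (simp add: arc_derivative_def vector_derivative_works)

text \<open>The rotation monodromy of the associated curve is conjugation by \<open>monodromy \<tau> x0 A F\<close>.\<close>

lemma monodromy_associated_curve:
  assumes \<tau>: "translation \<tau>" and A: "A \<in> SU2" and \<gamma>: "\<gamma> \<in> curves \<tau> A a"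
    and F: "is_frame x0 \<gamma> l F" and \<delta>: "is_associated_curve x0 \<gamma> F \<delta>"
  shows "\<exists>b. \<forall>x. \<delta> (\<tau> x) = Ad (monodromy \<tau> x0 A F) (\<delta> x) + b"
proof -
  interpret matmul: bounded_bilinear "(**) :: complex^2^2 \<Rightarrow> complex^2^2 \<Rightarrow> complex^2^2"
    by (rule bilinear_matmul)
  let ?T = "unit_tangent \<gamma>" and ?s = "speed \<gamma>"
  have d\<gamma>: "(\<gamma> has_vector_derivative ?s x *\<^sub>R ?T x) (at x)" and s: "?s x > 0" for x
  proof -
    show s: "?s x > 0" using \<gamma> by (simp add: curves_def speed_def)
    have "Ck_on 1 UNIV \<gamma>" using \<gamma> by (simp add: curves_def smooth_on_def del: Ck_on.simps)
    then have "\<gamma> differentiable (at x)" by simp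
    then show "(\<gamma> has_vector_derivative ?s x *\<^sub>R ?T x) (at x)"
      using s by (simp add: unit_tangent_def arc_derivative_def vector_derivative_works)
  qed
  have norm_T: "norm (?T x) = 1" for x
    using s[of x] by (simp add: unit_tangent_def arc_derivative_def speed_def)
  have dF: "(F has_vector_derivative ?s x *\<^sub>R (F x ** su2 (l *\<^sub>R ?T x))) (at x)"
    and FSU: "F x \<in> SU2" for x
    using F has_vector_derivative_arc_derivative[OF _ s[of x], of F]
    by (auto simp: is_frame_def)
  have d\<delta>: "(\<delta> has_vector_derivative ?s x *\<^sub>R Ad (F x) (?T x)) (at x)" for x
    using \<delta> has_vector_derivative_arc_derivative[OF _ s[of x], of \<delta>]
    by (auto simp: is_associated_curve_def)
  have "\<forall>x. \<exists>d. (\<tau> has_real_derivative d) (at x) \<and> d \<ge> 0"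
    using translation_deriv[OF \<tau>] by metis
  then obtain \<tau>' where d\<tau>: "\<And>x. (\<tau> has_real_derivative \<tau>' x) (at x)" and \<tau>'0: "\<And>x. \<tau>' x \<ge> 0"
    by metis
  have chain: "((\<lambda>x. f (\<tau> x)) has_vector_derivative \<tau>' x *\<^sub>R f') (at x)"
    if "(f has_vector_derivative f') (at (\<tau> x))" for f :: "real \<Rightarrow> 'b::real_normed_vector" and f' x
    using vector_diff_chain_at[of \<tau> "\<tau>' x" x f f'] d\<tau>[of x] that
    by (simp add: has_real_derivative_iff_has_vector_derivative o_def)
  have key: "\<tau>' x * ?s (\<tau> x) = ?s x" "?T (\<tau> x) = Ad A (?T x)" for x
  proof -
    have "((\<lambda>x. Ad A (\<gamma> x) + a) has_vector_derivative Ad A (?s x *\<^sub>R ?T x)) (at x)"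
      using bounded_linear.has_vector_derivative[OF linear_Ad[OF A] d\<gamma>[of x]]
      by (simp add: has_vector_derivative_add_const)
    moreover have "(\<lambda>x. \<gamma> (\<tau> x)) = (\<lambda>x. Ad A (\<gamma> x) + a)"
      using \<gamma> by (simp add: curves_def)
    ultimately have "\<tau>' x *\<^sub>R (?s (\<tau> x) *\<^sub>R ?T (\<tau> x)) = Ad A (?s x *\<^sub>R ?T x)"
      using chain[OF d\<gamma>] by (metis vector_derivative_unique_at)
    then have eq: "(\<tau>' x * ?s (\<tau> x)) *\<^sub>R ?T (\<tau> x) = ?s x *\<^sub>R Ad A (?T x)"
      using linear_Ad[OF A] by (simp add: linear_simps)
    from arg_cong[OF this, of norm] show 1: "\<tau>' x * ?s (\<tau> x) = ?s x"
      using \<tau>'0[of x] s[of x] s[of "\<tau> x"] by (simp add: norm_Ad A norm_T abs_mult)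
    show "?T (\<tau> x) = Ad A (?T x)" using eq s[of x] unfolding 1 by simp
  qed
  let ?B = "monodromy \<tau> x0 A F"
  have BSU: "?B \<in> SU2" using FSU A by (simp add: monodromy_def SU2_mult)
  define G where "G x = F (\<tau> x) ** A" for x
  have GSU: "G x \<in> SU2" for x using FSU A by (simp add: G_def SU2_mult)
  have AA: "adjoint_mat A ** A = mat 1" using SU2_inv[OF A] by simp
  have dG: "(G has_vector_derivative ?s x *\<^sub>R (G x ** su2 (l *\<^sub>R ?T x))) (at x)" for x
  proof -
    have "su2 (l *\<^sub>R ?T (\<tau> x)) ** A = A ** su2 (l *\<^sub>R ?T x)"
    proof -
      have "l *\<^sub>R ?T (\<tau> x) = Ad A (l *\<^sub>R ?T x)" using key linear_Ad[OF A] by (simp add: linear_simps)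
      then have "su2 (l *\<^sub>R ?T (\<tau> x)) ** A = A ** su2 (l *\<^sub>R ?T x) ** (adjoint_mat A ** A)"
        by (simp add: su2_Ad A matrix_mul_assoc)
      then show ?thesis by (simp add: AA)
    qed
    then have "\<tau>' x *\<^sub>R (?s (\<tau> x) *\<^sub>R (F (\<tau> x) ** su2 (l *\<^sub>R ?T (\<tau> x)))) ** A
        = ?s x *\<^sub>R (G x ** su2 (l *\<^sub>R ?T x))"
      by (simp add: matmul.scaleR_left G_def key matrix_mul_assoc[symmetric])
    then show ?thesis
      using bounded_linear.has_vector_derivative[OF matmul.bounded_linear_left[of A] chain[OF dF[of "\<tau> x"]]]
      by (simp add: G_def[abs_def])
  qed
  have "((\<lambda>x. G x ** adjoint_mat (F x)) has_vector_derivative 0) (at x)" for x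
  proof -
    let ?S = "su2 (l *\<^sub>R ?T x)"
    have ad: "adjoint_mat ?S = - ?S" using bij_betw_su2 by (auto simp: bij_betw_def)
    have dFa: "((\<lambda>x. adjoint_mat (F x)) has_vector_derivative
        ?s x *\<^sub>R (- ?S ** adjoint_mat (F x))) (at x)"
      using bounded_linear.has_vector_derivative[OF bounded_linear_adjoint_mat dF[of x]]
      by (simp add: linear_simps bounded_linear_adjoint_mat adjoint_mat_mult ad
          linear_scale[OF bounded_linear.linear[OF bounded_linear_adjoint_mat]])
    have "((\<lambda>x. G x ** adjoint_mat (F x)) has_vector_derivative
        G x ** (?s x *\<^sub>R (- ?S ** adjoint_mat (F x)))
        + (?s x *\<^sub>R (G x ** ?S)) ** adjoint_mat (F x)) (at x)"
      by (rule matmul.has_vector_derivative[OF dG dFa])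
    then show ?thesis
      by (simp add: matmul.scaleR_left matmul.scaleR_right matmul.minus_left matmul.minus_right
          matrix_mul_assoc)
  qed
  then obtain C where C: "G x ** adjoint_mat (F x) = C" for x
    using has_vector_derivative_zero_constant[of UNIV "\<lambda>x. G x ** adjoint_mat (F x)"] by auto
  have "C = ?B"
    using C[of x0] F by (simp add: G_def monodromy_def is_frame_def SU2_inv adjoint_mat_def
      mat_def vec_eq_iff forall_2 matrix_matrix_mult_def sum_2)
  have G: "G x = ?B ** F x" for x
  proof -
    have "G x = G x ** (adjoint_mat (F x) ** F x)" using SU2_inv[OF FSU[of x]] by simp
    also have "\<dots> = ?B ** F x" using C[of x] \<open>C = ?B\<close> by (simp add: matrix_mul_assoc)
    finally show ?thesis .
  qed
  have "((\<lambda>x. \<delta> (\<tau> x) - Ad ?B (\<delta> x)) has_vector_derivative 0) (at x)" for x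
  proof -
    have "\<tau>' x *\<^sub>R (?s (\<tau> x) *\<^sub>R Ad (F (\<tau> x)) (?T (\<tau> x))) = ?s x *\<^sub>R Ad (G x) (?T x)"
      by (simp add: key G_def Ad_mult FSU A)
    also have "\<dots> = Ad ?B (?s x *\<^sub>R Ad (F x) (?T x))"
      using linear_Ad[OF BSU] by (simp add: G Ad_mult BSU FSU linear_simps)
    finally show ?thesis
      using has_vector_derivative_diff[OF chain[OF d\<delta>[of "\<tau> x"]]
          bounded_linear.has_vector_derivative[OF linear_Ad[OF BSU] d\<delta>[of x]]] by simp
  qed
  then obtain b where "\<delta> (\<tau> x) - Ad ?B (\<delta> x) = b" for x
    using has_vector_derivative_zero_constant[of UNIV "\<lambda>x. \<delta> (\<tau> x) - Ad ?B (\<delta> x)"] by auto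
  then show ?thesis by (metis add.commute diff_add_cancel)
qed

end

theory Submission
  imports Defs
begin

text \<open>
  Along a variation \<open>\<gamma>\<^sub>t\<close> with velocity \<open>\<xi>\<close>, let \<open>B\<^sub>t = F\<^sub>t(\<tau> x0) A\<close> be the monodromies in \<open>SU2\<close>. The derivative of
  their rotation angle is computed from three observations.

  The angle: with \<open>z\<close> the infinitesimal rotation \<open>B' B\<^sub>0\<^sup>-\<^sup>1\<close>, the angle changes at the rate \<open>z \<bullet> y\<close>, where \<open>y\<close> is
  the axis of \<open>B\<^sub>0\<close>, since only the component of \<open>z\<close> along the axis changes the angle to first order. Since the
  axis varies continuously with \<open>t\<close>, this remains true for \<open>B\<^sub>0 = \<plusminus> 1\<close>, where \<open>B\<^sub>0\<close> alone determines no axis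
  (\<open>angle_derivative\<close>).

  The frame: variation of parameters in \<open>F' = F \<lambda> \<gamma>'\<close>, followed by an integration by parts, gives
  \<open>z = \<lambda> (Ad F(\<tau> x0) \<xi>(\<tau> x0) - \<xi>(x0)) - \<lambda>\<^sup>2 \<integral> Ad F (\<gamma>' \<times> \<xi>)\<close> (\<open>frame_derivative\<close>). The second power of \<open>\<lambda>\<close>
  in the theorem comes from this integration by parts.

  The pairing with \<open>y\<close>: the boundary terms cancel because \<open>\<xi>\<close> is equivariant under \<open>\<tau>\<close> and \<open>y\<close> is fixed by
  the monodromy. In the integral \<open>Ad F\<close> is moved to \<open>y\<close>, which becomes the axis field \<open>Y\<close>, and
  \<open>- (\<gamma>' \<times> \<xi>) \<bullet> Y = det (\<gamma>', Y, \<xi>)\<close> (\<open>monodromy_angle_derivative\<close>).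

  Hence \<open>\<lambda>\<^sup>2 \<sigma>(Y, -)\<close> is the differential of the angle. That \<open>Y\<close> is itself a tangent vector follows from its
  linear differential equation \<open>Y' = \<lambda> Y \<times> \<gamma>'\<close> (\<open>axis_field_in_tangent_space\<close>).
\<close>

section \<open>Quaternion algebra of \<open>SU2\<close>\<close>

lemma bounded_linear_su2: "bounded_linear su2"
  using linear_su2 by (simp add: linear_conv_bounded_linear)

lemmas su2_linear = linear_simps[OF bounded_linear_su2]
  and adjoint_linear = linear_simps[OF bounded_linear_adjoint_mat]

interpretation matmul: bounded_bilinear "(**) :: complex^2^2 \<Rightarrow> complex^2^2 \<Rightarrow> complex^2^2"
  by (rule bilinear_matmul)

lemma bounded_bilinear_cross3: "bounded_bilinear cross3"
  using bilinear_cross by (simp add: bilinear_conv_bounded_bilinear)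

interpretation cross: bounded_bilinear cross3
  by (rule bounded_bilinear_cross3)

lemma adjoint_su2: "adjoint_mat (su2 v) = - su2 v"
  using bij_betw_su2 by (auto simp: bij_betw_def)

lemma adjoint_adjoint [simp]: "adjoint_mat (adjoint_mat B) = B"
  by (simp add: adjoint_mat_def vec_eq_iff)

lemma adjoint_mat_1: "adjoint_mat (mat 1) = mat 1"
  by (simp add: adjoint_mat_def mat_def vec_eq_iff)

text \<open>Quaternion multiplication of imaginary quaternions; the factor \<open>1/2\<close> in \<open>su2\<close> accounts for the
constants \<open>1/4\<close> and \<open>1/2\<close>.\<close>

lemma su2_mult: "su2 v ** su2 w = - ((v \<bullet> w) / 4) *\<^sub>R mat 1 + (1 / 2) *\<^sub>R su2 (cross3 v w)"
  by (simp add: vec_eq_iff forall_2 su2_def cross3_def matrix_matrix_mult_def sum_2 mat_def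
      inner_vec_def sum_3 complex_eq_iff algebra_simps add_divide_distrib diff_divide_distrib)

lemma mat_1_in_SU2: "mat 1 \<in> SU2"
  by (simp add: SU2_def adjoint_mat_def mat_def vec_eq_iff forall_2 matrix_matrix_mult_def sum_2 det_2)

lemma adjoint_SU2: assumes "B \<in> SU2" shows "adjoint_mat B \<in> SU2"
proof -
  have "det (adjoint_mat B) = 1"
    using arg_cong[OF SU2_inv(1)[OF assms], of det] assms by (simp add: det_mul SU2_def)
  then show ?thesis using SU2_inv(2)[OF assms] by (simp add: SU2_def)
qed

lemma Ad_adjoint_Ad: assumes "B \<in> SU2" shows "Ad (adjoint_mat B) (Ad B v) = v"
  by (rule injD[OF inj_su2])
    (simp add: su2_Ad assms adjoint_SU2 matrix_mul_assoc SU2_inv,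
     simp add: matrix_mul_assoc[symmetric] assms SU2_inv)

lemma Ad_Ad_adjoint: assumes "B \<in> SU2" shows "Ad B (Ad (adjoint_mat B) v) = v"
  using Ad_adjoint_Ad[OF adjoint_SU2[OF assms]] by simp

lemma inner_Ad_Ad: assumes "B \<in> SU2" shows "Ad B v \<bullet> Ad B w = v \<bullet> w"
proof -
  have "orthogonal_transformation (Ad B)"
    by (simp add: orthogonal_transformation norm_Ad assms bounded_linear.linear[OF linear_Ad])
  then show ?thesis by (simp add: orthogonal_transformation_def)
qed

lemma inner_Ad: assumes "B \<in> SU2" shows "Ad B v \<bullet> w = v \<bullet> Ad (adjoint_mat B) w"
  by (metis Ad_Ad_adjoint assms inner_Ad_Ad)

lemma su2_intertwine: assumes "B \<in> SU2" shows "B ** su2 v = su2 (Ad B v) ** B"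
  by (simp add: su2_Ad assms matrix_mul_assoc[symmetric] SU2_inv)

lemma Ad_cross3: assumes "B \<in> SU2" shows "Ad B (cross3 v w) = cross3 (Ad B v) (Ad B w)"
proof (rule injD[OF inj_su2])
  have "B ** (su2 v ** su2 w) ** adjoint_mat B = su2 (Ad B v) ** su2 (Ad B w)" for v w
    by (simp add: matrix_mul_assoc su2_intertwine[OF assms])
      (simp add: matrix_mul_assoc[symmetric] su2_Ad[OF assms])
  then show "su2 (Ad B (cross3 v w)) = su2 (cross3 (Ad B v) (Ad B w))"
    by (simp add: su2_cross su2_Ad[OF assms, of "cross3 v w"] matmul.diff_left matmul.diff_right)
qed

lemma norm_le_sum_components:
  fixes x :: "'a::real_normed_vector ^ 'n"
  shows "norm x \<le> (\<Sum>i\<in>UNIV. norm (x$i))"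
  unfolding norm_vec_def by (rule L2_set_le_sum) simp

lemma bounded_SU2: "bounded SU2"
proof -
  have "norm B \<le> 4" if "B \<in> SU2" for B
  proof -
    have "norm (B$i$j) \<le> 1" for i j
    proof -
      have "(B ** adjoint_mat B)$i$i = 1" using SU2_inv(1)[OF that] by (simp add: mat_def)
      then have "complex_of_real ((cmod (B$i$1))\<^sup>2 + (cmod (B$i$2))\<^sup>2) = 1"
        by (simp add: matrix_matrix_mult_def adjoint_mat_def sum_2 of_real_add complex_norm_square
            del: of_real_power of_real_eq_1_iff)
      then have "(cmod (B$i$1))\<^sup>2 + (cmod (B$i$2))\<^sup>2 = 1"
        by (metis of_real_eq_1_iff)
      then have "(cmod (B$i$j))\<^sup>2 \<le> 1" using exhaust_2[of j]
        by (metis le_add_same_cancel1 le_add_same_cancel2 zero_le_power2)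
      then show ?thesis by (simp add: power_le_one_iff)
    qed
    then have row: "norm (B$i) \<le> 2" for i
      using norm_le_sum_components[of "B$i"] add_mono[of "norm (B$i$1)" 1 "norm (B$i$2)" 1]
      by (simp add: sum_2)
    show ?thesis
      using norm_le_sum_components[of B] add_mono[OF row[of 1] row[of 2]] by (simp add: sum_2)
  qed
  then show ?thesis unfolding bounded_iff by blast
qed

text \<open>The exponential of \<open>su2 (\<phi> *\<^sub>R y)\<close> for a unit vector \<open>y\<close>, one of the two lifts to \<open>SU2\<close> of the rotation
by \<open>\<phi>\<close> about \<open>y\<close>.\<close>

definition rotation_lift :: "real^3 \<Rightarrow> real \<Rightarrow> complex^2^2" where
  "rotation_lift y \<phi> = cos (\<phi> / 2) *\<^sub>R mat 1 + (2 * sin (\<phi> / 2)) *\<^sub>R su2 y"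

lemma rotation_lift_SU2:
  assumes "norm y = 1"
  shows "rotation_lift y \<phi> \<in> SU2"
proof -
  have y: "y$1 * y$1 + y$2 * y$2 + y$3 * y$3 = 1" 
    using assms by (simp add: norm_eq_1 inner_vec_def sum_3)
  have yy: "y \<bullet> y = 1" using assms by (simp add: norm_eq_1)
  have "rotation_lift y \<phi> ** adjoint_mat (rotation_lift y \<phi>) = ((cos (\<phi>/2))\<^sup>2 + (sin (\<phi>/2))\<^sup>2) *\<^sub>R mat 1"
    by (simp add: rotation_lift_def adjoint_linear adjoint_mat_1 adjoint_su2 matmul.add_left matmul.add_right
        matmul.diff_right matmul.minus_right matmul.scaleR_left matmul.scaleR_right su2_mult yy su2_linear power2_eq_square algebra_simps)
     (simp add: scaleR_left_distrib[symmetric])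
  moreover have "det (rotation_lift y \<phi>) = of_real ((cos (\<phi>/2))\<^sup>2 + (sin (\<phi>/2))\<^sup>2 * (y$1 * y$1 + y$2 * y$2 + y$3 * y$3))"
    by (simp add: det_2 rotation_lift_def su2_def mat_def complex_eq_iff power2_eq_square algebra_simps)
  ultimately show ?thesis by (simp add: SU2_def y)
qed

lemma Ad_rotation_lift:
  assumes "norm y = 1"
  shows "Ad (rotation_lift y \<phi>) v = rotation y \<phi> v"
proof (rule injD[OF inj_su2])
  define c s where "c = cos (\<phi>/2)" and "s = sin (\<phi>/2)"
  have yy: "y \<bullet> y = 1" using assms by (simp add: norm_eq_1)
  have cs: "c\<^sup>2 + s\<^sup>2 = 1" by (simp add: c_def s_def)
  have cos: "cos \<phi> = c\<^sup>2 - s\<^sup>2" and sin: "sin \<phi> = 2 * s * c"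
    using cos_double[of "\<phi>/2"] sin_double[of "\<phi>/2"] by (simp_all add: c_def s_def)
  have cos': "1 - cos \<phi> = 2 * s\<^sup>2" using cs cos by simp
  \<comment> \<open>The quaternion identity \<open>y v y = \<bar>y\<bar>\<^sup>2 v - 2 (y \<bullet> v) y\<close> up to the normalisation of \<open>su2\<close>.\<close>
  have yvy: "su2 y ** su2 v ** su2 y = (1 / 4) *\<^sub>R su2 v - ((y \<bullet> v) / 2) *\<^sub>R su2 y"
  proof -
    have "cross3 (cross3 y v) y = v - (y \<bullet> v) *\<^sub>R y"
      using Lagrange[of y y v] cross_skew[of "cross3 y v" y] by (simp add: yy)
    then show ?thesis
      by (simp add: su2_mult matmul.add_left matmul.diff_left matmul.minus_left matmul.scaleR_left dot_cross_self su2_linear)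
       (simp add: vec_eq_iff complex_eq_iff field_simps)
  qed
  have "su2 (Ad (rotation_lift y \<phi>) v) = (c\<^sup>2) *\<^sub>R su2 v + (2 * s * c) *\<^sub>R (su2 y ** su2 v - su2 v ** su2 y)
      - (4 * s\<^sup>2) *\<^sub>R (su2 y ** su2 v ** su2 y)"
    unfolding su2_Ad[OF rotation_lift_SU2[OF assms]]
    unfolding rotation_lift_def c_def[symmetric] s_def[symmetric]
    by (simp add: adjoint_linear adjoint_mat_1 adjoint_su2 matmul.add_left matmul.add_right
        matmul.diff_left matmul.diff_right matmul.minus_right matmul.scaleR_left matmul.scaleR_right
        power2_eq_square matrix_mul_assoc)
     (simp add: algebra_simps)
  also have "\<dots> = su2 (rotation y \<phi> v)"
    unfolding yvy su2_cross[symmetric] rotation_def cos' unfolding sin cos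
    by (simp add: su2_linear algebra_simps)
  finally show "su2 (Ad (rotation_lift y \<phi>) v) = su2 (rotation y \<phi> v)" .
qed

text \<open>The kernel of the adjoint action is the centre: an element that commutes with all of \<open>su2\<close> is scalar,
and its determinant forces the scalar to be a sign.\<close>

lemma SU2_eq_if_Ad_eq:
  assumes B: "B \<in> SU2" and C: "C \<in> SU2" and eq: "\<And>v. Ad B v = Ad C v"
  shows "B = C \<or> B = - C"
proof -
  define D where "D = adjoint_mat C ** B"
  have D: "D \<in> SU2" by (simp add: D_def SU2_mult adjoint_SU2 B C)
  have "Ad D v = v" for v by (simp add: D_def Ad_mult adjoint_SU2 B C eq Ad_adjoint_Ad)
  then have comm: "D ** su2 v = su2 v ** D" for v using su2_intertwine[OF D] by metis
  \<comment> \<open>Commuting with \<open>\<sigma>\<^sub>3\<close> makes \<open>D\<close> diagonal; commuting with \<open>\<sigma>\<^sub>1\<close> equates the diagonal entries.\<close>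
  have 1: "D$1$2 = 0" "D$2$1 = 0"
    using comm[of "vector [0, 0, 1]"]
    by (simp_all add: vec_eq_iff forall_2 su2_def matrix_matrix_mult_def sum_2 complex_eq_iff)
  moreover have 2: "D$1$1 = D$2$2"
    using arg_cong[OF comm[of "vector [1, 0, 0]"], of "\<lambda>X. X$1$2"]
    by (simp add: su2_def matrix_matrix_mult_def sum_2 Complex_eq_0)
  ultimately have "D$1$1 * D$1$1 = 1" using D by (simp add: SU2_def det_2)
  then have "D$1$1 = 1 \<or> D$1$1 = - 1" using square_eq_1_iff by blast
  then have "D = mat 1 \<or> D = - mat 1"
    using 1 2 by (auto simp: vec_eq_iff forall_2 mat_def)
  moreover have "B = C ** D" by (simp add: D_def matrix_mul_assoc SU2_inv C)
  ultimately show ?thesis by (auto simp: matmul.minus_right)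
qed

lemma rotation_angle_lift:
  assumes "B \<in> SU2" "norm y = 1" "is_rotation_angle B y \<phi>"
  shows "B = rotation_lift y \<phi> \<or> B = - rotation_lift y \<phi>"
  using assms by (intro SU2_eq_if_Ad_eq) (simp_all add: rotation_lift_SU2 Ad_rotation_lift is_rotation_angle_def)

section \<open>The rate of change of a rotation angle\<close>

definition re_trace :: "complex^2^2 \<Rightarrow> real" where
  "re_trace X = Re (trace X)"

lemma bounded_linear_re_trace: "bounded_linear re_trace"
  by (rule linear_conv_bounded_linear[THEN iffD1], rule linearI)
    (simp_all add: re_trace_def trace_def sum_2 algebra_simps)

lemmas re_trace_linear = linear_simps[OF bounded_linear_re_trace]

text \<open>In terms of quaternions \<open>re_trace\<close> reads off the scalar part, and \<open>X \<mapsto> re_trace (X ** su2 v)\<close> the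
component along \<open>v\<close> of the imaginary part.\<close>

lemma re_trace_simps:
  "re_trace (mat 1) = 2" "re_trace (su2 v) = 0" "re_trace (su2 v ** su2 w) = - (v \<bullet> w) / 2"
proof -
  show 1: "re_trace (mat 1) = 2" and 2: "re_trace (su2 v) = 0" for v
    by (simp_all add: re_trace_def trace_def sum_2 mat_def su2_def)
  show "re_trace (su2 v ** su2 w) = - (v \<bullet> w) / 2"
    by (simp add: su2_mult re_trace_linear 1 2)
qed

text \<open>Write \<open>B t = c t + 2 s t su2 (Y t)\<close>, so that \<open>(c, s)\<close> is \<open>(cos, sin)\<close> of half the angle up to a common sign. Both
are differentiable at \<open>0\<close>: \<open>c\<close> is half the trace of \<open>B\<close>, and \<open>s\<close> is a pairing of \<open>B\<close> with the axis. The axis is only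
known to be continuous, but \<open>2 s Y\<close> is the imaginary part of \<open>B\<close>, and pairing its increment with \<open>Y t + Y 0\<close>
gives \<open>2 (s t - s 0) (1 + Y t \<bullet> Y 0)\<close>, in which the increment of \<open>Y\<close> has dropped out. This covers
\<open>B 0 = \<plusminus> 1\<close>, where \<open>B\<close> does not determine the axis. The lift of \<open>\<theta>\<close> is \<open>\<theta> 0 + 2 arcsin u\<close> with
\<open>u = s c 0 - c s 0\<close>, up to sign the sine of half the increment of \<open>\<theta>\<close>.\<close>

lemma angle_derivative:
  fixes B :: "real \<Rightarrow> complex^2^2" and Y :: "real \<Rightarrow> real^3" and \<theta> :: "real \<Rightarrow> real"
  assumes ev: "\<forall>\<^sub>F t in nhds 0. B t \<in> SU2 \<and> norm (Y t) = 1 \<and> is_rotation_angle (B t) (Y t) (\<theta> t)"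
    and dB: "((\<lambda>t. (B t - B 0) /\<^sub>R t) \<longlongrightarrow> su2 z ** B 0) (at 0)"
    and Y: "isCont Y 0"
  shows "has_derivative_mod (2 * pi) \<theta> (z \<bullet> Y 0)"
proof -
  define c where "c t = re_trace (B t) / 2" for t
  define s where "s t = - re_trace (B t ** su2 (Y t))" for t
  define u where "u t = s t * c 0 - c t * s 0" for t
  \<comment> \<open>The sign \<open>e\<close> depends on \<open>t\<close> since \<open>\<theta> t\<close> may jump by multiples of \<open>2 pi\<close>.\<close>
  have ev': "\<forall>\<^sub>F t in nhds 0. \<exists>e. (e = 1 \<or> e = - 1) \<and> c t = e * cos (\<theta> t / 2) \<and> s t = e * sin (\<theta> t / 2)
      \<and> B t = c t *\<^sub>R mat 1 + (2 * s t) *\<^sub>R su2 (Y t) \<and> norm (Y t) = 1"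
    using ev
  proof eventually_elim
    case (elim t)
    then have "B t = rotation_lift (Y t) (\<theta> t) \<or> B t = - rotation_lift (Y t) (\<theta> t)"
      by (intro rotation_angle_lift) auto
    then obtain e :: real where e: "e = 1 \<or> e = - 1" and B: "B t = e *\<^sub>R rotation_lift (Y t) (\<theta> t)"
      by (metis scaleR_minus1_left scaleR_one)
    have YY: "Y t \<bullet> Y t = 1" using elim by (simp add: norm_eq_1)
    have c: "c t = e * cos (\<theta> t / 2)"
      by (simp add: c_def B rotation_lift_def re_trace_linear re_trace_simps)
    have s: "s t = e * sin (\<theta> t / 2)"
      by (simp add: s_def B rotation_lift_def re_trace_linear re_trace_simps matmul.add_left
          matmul.scaleR_left YY)
    show ?case using e c s elim
      by (intro exI[of _ e]) (auto simp: B rotation_lift_def)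
  qed
  from eventually_nhds_x_imp_x[OF this] obtain e0 :: real
    where e0: "e0 = 1 \<or> e0 = - 1" and c0: "c 0 = e0 * cos (\<theta> 0 / 2)" and s0: "s 0 = e0 * sin (\<theta> 0 / 2)"
    and B0: "B 0 = c 0 *\<^sub>R mat 1 + (2 * s 0) *\<^sub>R su2 (Y 0)" and Y0: "norm (Y 0) = 1" by blast
  have Y0Y0: "Y 0 \<bullet> Y 0 = 1" using Y0 by (simp add: norm_eq_1)
  have "(cos (\<theta> 0 / 2))\<^sup>2 + (sin (\<theta> 0 / 2))\<^sup>2 = 1" by simp
  then have one: "(c 0)\<^sup>2 + (s 0)\<^sup>2 = 1" using e0 unfolding c0 s0 by auto
  have dc: "(c has_real_derivative - s 0 * (z \<bullet> Y 0) / 2) (at 0)"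
  proof -
    have "((\<lambda>t. re_trace ((B t - B 0) /\<^sub>R t) / 2) \<longlongrightarrow> re_trace (su2 z ** B 0) / 2) (at 0)"
      by (intro tendsto_intros bounded_linear.tendsto[OF bounded_linear_re_trace] dB) simp
    moreover have "re_trace (su2 z ** B 0) / 2 = - s 0 * (z \<bullet> Y 0) / 2"
      unfolding B0 by (simp add: matmul.add_right matmul.scaleR_right re_trace_linear re_trace_simps)
    moreover have "re_trace ((B t - B 0) /\<^sub>R t) / 2 = (c (0 + t) - c 0) / t" for t
      unfolding c_def re_trace_linear by (cases "t = 0") (simp_all add: field_simps)
    ultimately show ?thesis unfolding DERIV_def by simp
  qed
  have ds: "(s has_real_derivative c 0 * (z \<bullet> Y 0) / 2) (at 0)"
  proof -
    have Yt: "Y \<midarrow>0\<rightarrow> Y 0" using Y by (simp add: isCont_def)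
    have d: "((\<lambda>t. 1 + Y t \<bullet> Y 0) \<longlongrightarrow> 2) (at 0)"
      using tendsto_add[OF tendsto_const[of 1] tendsto_inner[OF Yt tendsto_const[of "Y 0"]]]
      by (simp add: Y0Y0)
    have lim: "((\<lambda>t. - re_trace (((B t - B 0) /\<^sub>R t) ** su2 (Y t + Y 0)) / (1 + Y t \<bullet> Y 0)) \<longlongrightarrow>
        - re_trace ((su2 z ** B 0) ** su2 (Y 0 + Y 0)) / 2) (at 0)"
      by (intro tendsto_intros bounded_linear.tendsto[OF bounded_linear_re_trace] dB matmul.tendsto
          bounded_linear.tendsto[OF bounded_linear_su2] d Yt) simp
    have val: "- re_trace ((su2 z ** B 0) ** su2 (Y 0 + Y 0)) / 2 = c 0 * (z \<bullet> Y 0) / 2"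
    proof -
      have two: "su2 (Y 0 + Y 0) = 2 *\<^sub>R su2 (Y 0)" by (simp only: su2_linear scaleR_2)
      have "(su2 z ** su2 (Y 0)) ** su2 (Y 0) = (- 1 / 4) *\<^sub>R su2 z"
        by (simp add: matrix_mul_assoc[symmetric] su2_mult[of "Y 0"] Y0Y0 su2_linear matmul.add_right
            matmul.minus_right matmul.scaleR_right)
      then show ?thesis
        unfolding B0 two by (simp add: matmul.add_left matmul.add_right matmul.scaleR_right
            matmul.scaleR_left re_trace_linear re_trace_simps su2_linear)
    qed
    have quot: "\<forall>\<^sub>F t in at 0. - re_trace (((B t - B 0) /\<^sub>R t) ** su2 (Y t + Y 0)) / (1 + Y t \<bullet> Y 0)
        = (s (0 + t) - s 0) / t"
    proof -
      have "\<forall>\<^sub>F t in at 0. 1 + Y t \<bullet> Y 0 > 0"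
        using order_tendstoD(1)[OF d, of 0] by simp
      moreover have "\<forall>\<^sub>F t in at 0. B t = c t *\<^sub>R mat 1 + (2 * s t) *\<^sub>R su2 (Y t) \<and> norm (Y t) = 1"
        using ev' by (auto simp: eventually_at_filter elim: eventually_mono)
      moreover have "\<forall>\<^sub>F t :: real in at 0. t \<noteq> 0" by (simp add: eventually_at_filter)
      ultimately show ?thesis
      proof eventually_elim
        case (elim t)
        have "Y t \<bullet> Y t = 1" using elim by (simp add: norm_eq_1)
        then have 1: "re_trace (B t ** su2 (Y t + Y 0)) = - s t * (1 + Y t \<bullet> Y 0)"
          using elim by (simp add: matmul.add_right matmul.add_left matmul.scaleR_left su2_linear
             re_trace_linear re_trace_simps algebra_simps)
        have 2: "re_trace (B 0 ** su2 (Y t + Y 0)) = - s 0 * (1 + Y t \<bullet> Y 0)"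
          unfolding B0 by (simp add: matmul.add_right matmul.add_left matmul.scaleR_left su2_linear
             re_trace_linear re_trace_simps Y0Y0 inner_commute algebra_simps)
        have "- re_trace (((B t - B 0) /\<^sub>R t) ** su2 (Y t + Y 0)) = (s t - s 0) / t * (1 + Y t \<bullet> Y 0)"
          unfolding matmul.diff_left matmul.scaleR_left re_trace_linear 1 2
          using \<open>t \<noteq> 0\<close> by (simp add: field_simps)
        then show ?case using elim by simp
      qed
    qed
    show ?thesis
      unfolding DERIV_def by (rule Lim_transform_eventually[OF lim[unfolded val] quot])
  qed
  have du: "(u has_real_derivative z \<bullet> Y 0 / 2) (at 0)"
  proof -
    have "(u has_real_derivative c 0 * (z \<bullet> Y 0) / 2 * c 0 - - s 0 * (z \<bullet> Y 0) / 2 * s 0) (at 0)"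
      unfolding u_def by (intro DERIV_diff DERIV_cmult_right ds dc)
    moreover have "c 0 * (z \<bullet> Y 0) / 2 * c 0 - - s 0 * (z \<bullet> Y 0) / 2 * s 0 = ((c 0)\<^sup>2 + (s 0)\<^sup>2) * (z \<bullet> Y 0) / 2"
      by (simp add: power2_eq_square algebra_simps)
    ultimately show ?thesis by (simp only: one mult_1_left)
  qed
  have u0: "u 0 = 0" by (simp add: u_def)
  define \<phi> where "\<phi> t = \<theta> 0 + 2 * arcsin (u t)" for t
  have "((\<lambda>t. arcsin (u t)) has_real_derivative inverse (sqrt (1 - 0\<^sup>2)) * (z \<bullet> Y 0 / 2)) (at 0)"
    by (rule DERIV_chain2[where f=arcsin, OF _ du]) (use DERIV_arcsin[of 0] u0 in simp)
  then have "((\<lambda>t. \<theta> 0 + 2 * arcsin (u t)) has_real_derivative 0 + 2 * (z \<bullet> Y 0 / 2)) (at 0)"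
    by (intro DERIV_add DERIV_const DERIV_cmult) simp
  then have "(\<phi> has_real_derivative z \<bullet> Y 0) (at 0)" by (simp add: \<phi>_def[abs_def])
  moreover have "\<forall>\<^sub>F t in nhds 0. \<exists>k::int. \<theta> t = \<phi> t + of_int k * (2 * pi)"
  proof -
    have "isCont (\<lambda>t. c t * c 0 + s t * s 0) 0"
      by (intro continuous_intros DERIV_isCont[OF dc] DERIV_isCont[OF ds])
    then have "((\<lambda>t. c t * c 0 + s t * s 0) \<longlongrightarrow> c 0 * c 0 + s 0 * s 0) (nhds 0)"
      by (simp add: isCont_def tendsto_at_iff_tendsto_nhds[of "\<lambda>t. c t * c 0 + s t * s 0"])
    moreover have "c 0 * c 0 + s 0 * s 0 > 0" using one by (simp add: power2_eq_square)
    ultimately have "\<forall>\<^sub>F t in nhds 0. c t * c 0 + s t * s 0 > 0" by (rule order_tendstoD(1))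
    with ev' show ?thesis
    proof eventually_elim
      case (elim t)
      then obtain e :: real where e: "e = 1 \<or> e = - 1" and ct: "c t = e * cos (\<theta> t / 2)"
        and st: "s t = e * sin (\<theta> t / 2)" by blast
      define x where "x = (\<theta> t - \<theta> 0) / 2"
      have x: "x = \<theta> t / 2 - \<theta> 0 / 2" by (simp add: x_def diff_divide_distrib)
      \<comment> \<open>The signs at \<open>t\<close> and at \<open>0\<close> enter only through their product, which merely moves \<open>x\<close> by a
        multiple of \<open>pi\<close> and hence \<open>\<theta> t\<close> by a multiple of \<open>2 pi\<close>.\<close>
      have sinx: "u t = (e * e0) * sin x" and cosx: "c t * c 0 + s t * s 0 = (e * e0) * cos x"
        unfolding x by (simp_all add: u_def ct st c0 s0 sin_diff cos_diff algebra_simps)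
      have sq: "(e * e0)\<^sup>2 = 1" using e e0 by auto
      have "(u t)\<^sup>2 + ((e * e0) * cos x)\<^sup>2 = (e * e0)\<^sup>2 * ((sin x)\<^sup>2 + (cos x)\<^sup>2)"
        by (simp only: sinx power_mult_distrib distrib_left)
      then have sum: "(u t)\<^sup>2 + ((e * e0) * cos x)\<^sup>2 = 1" using sq by simp
      then have "(u t)\<^sup>2 \<le> 1" by (metis le_add_same_cancel1 zero_le_power2)
      then have u1: "- 1 \<le> u t" "u t \<le> 1" by (auto simp: abs_square_le_1 abs_le_iff)
      have "cos (arcsin (u t)) = (e * e0) * cos x"
        unfolding cos_arcsin[OF u1] using sum elim cosx
        by (intro real_sqrt_unique) auto
      then have "sin (x - arcsin (u t)) = 0"
        using u1 by (simp add: sin_diff) (simp add: sinx)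
      then obtain k :: int where "x - arcsin (u t) = of_int k * pi"
        by (auto simp: sin_zero_iff_int2)
      then show ?case by (intro exI[of _ k]) (simp add: \<phi>_def x_def field_simps)
    qed
  qed
  ultimately show ?thesis unfolding has_derivative_mod_def by blast
qed

section \<open>The rate of change of a frame\<close>

text \<open>Being linear and injective, \<open>su2\<close> has a linear left inverse, so calculus for vectors can be done
with matrices.\<close>

lemma has_vector_derivative_su2D:
  assumes "((\<lambda>x. su2 (f x)) has_vector_derivative su2 f') F"
  shows "(f has_vector_derivative f') F"
proof -
  obtain R where R: "linear R" "R \<circ> su2 = id"
    using linear_injective_left_inverse[OF linear_su2 inj_su2] by blast
  then have "R (su2 v) = v" for v by (metis comp_apply id_apply)
  then show ?thesis
    using bounded_linear.has_vector_derivative[OF _ assms, of R] R(1)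
    by (simp add: linear_conv_bounded_linear)
qed

lemma continuous_on_su2D:
  assumes "continuous_on S (\<lambda>x. su2 (f x))"
  shows "continuous_on S f"
proof -
  obtain R where R: "linear R" "R \<circ> su2 = id"
    using linear_injective_left_inverse[OF linear_su2 inj_su2] by blast
  then have "R (su2 v) = v" for v by (metis comp_apply id_apply)
  then show ?thesis
    using bounded_linear.continuous_on[OF _ assms, of R] R(1)
    by (simp add: linear_conv_bounded_linear)
qed

lemma continuous_on_Ad:
  assumes "continuous_on S F" "continuous_on S w" "\<And>x. x \<in> S \<Longrightarrow> F x \<in> SU2"
  shows "continuous_on S (\<lambda>x. Ad (F x) (w x))"
proof (rule continuous_on_su2D)
  have "continuous_on S (\<lambda>x. F x ** su2 (w x) ** adjoint_mat (F x))"
    by (intro matmul.continuous_on assms bounded_linear.continuous_on[OF bounded_linear_su2]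
        bounded_linear.continuous_on[OF bounded_linear_adjoint_mat])
  then show "continuous_on S (\<lambda>x. su2 (Ad (F x) (w x)))"
    using assms(3) by (simp add: su2_Ad cong: continuous_on_cong)
qed

text \<open>The mean value inequality for \<open>f t - g\<close>, whose derivative is uniformly small.\<close>

lemma uniform_limit_of_derivatives:
  fixes f :: "'t \<Rightarrow> real \<Rightarrow> 'b::real_normed_vector"
  assumes df: "\<forall>\<^sub>F t in \<Phi>. \<forall>y\<in>{a..b}. (f t has_vector_derivative f' t y) (at y within {a..b})"
    and dg: "\<And>y. y \<in> {a..b} \<Longrightarrow> (g has_vector_derivative g' y) (at y within {a..b})"
    and lim: "uniform_limit {a..b} f' g' \<Phi>" and init: "((\<lambda>t. f t a) \<longlongrightarrow> g a) \<Phi>"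
  shows "uniform_limit {a..b} f g \<Phi>"
proof (rule uniform_limitI)
  fix e :: real assume e: "e > 0"
  define D where "D = \<bar>b - a\<bar> + 1"
  have D: "D > 0" by (simp add: D_def add_nonneg_pos)
  define d where "d = e / (2 * D)"
  have d: "d > 0" using e D by (simp add: d_def)
  have "\<forall>\<^sub>F t in \<Phi>. dist (f t a) (g a) < e / 2" using tendstoD[OF init, of "e / 2"] e by simp
  with df uniform_limitD[OF lim d] show "\<forall>\<^sub>F t in \<Phi>. \<forall>y\<in>{a..b}. dist (f t y) (g y) < e"
  proof eventually_elim
    case (elim t)
    show ?case
    proof
      fix y assume y: "y \<in> {a..b}"
      have "norm ((f t y - g y) - (f t a - g a)) \<le> d * norm (y - a)"
      proof (rule differentiable_bound[where S="{a..b}" and f'="\<lambda>x h. h *\<^sub>R (f' t x - g' x)"])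
        fix x assume x: "x \<in> {a..b}"
        have "((\<lambda>x. f t x - g x) has_vector_derivative (f' t x - g' x)) (at x within {a..b})"
          using elim dg x by (intro has_vector_derivative_diff) auto
        then show "((\<lambda>x. f t x - g x) has_derivative (\<lambda>h. h *\<^sub>R (f' t x - g' x))) (at x within {a..b})"
          by (simp add: has_vector_derivative_def)
        show "onorm (\<lambda>h. h *\<^sub>R (f' t x - g' x)) \<le> d"
        proof (rule onorm_bound)
          have "norm (f' t x - g' x) \<le> d" using elim x by (auto simp: dist_norm less_imp_le)
          then show "norm (h *\<^sub>R (f' t x - g' x)) \<le> d * norm h" for h :: real
            using mult_left_mono[of _ d "\<bar>h\<bar>"] by (simp add: mult.commute[of d])
        qed (use d in simp)
      qed (use y in auto)
      also have "\<dots> \<le> d * D" using y d by (intro mult_left_mono) (auto simp: D_def)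
      also have "\<dots> = e / 2" using D by (simp add: d_def)
      finally have "norm (f t y - g y) \<le> e / 2 + norm (f t a - g a)"
        using norm_triangle_ineq2[of "f t y - g y" "f t a - g a"] by linarith
      then show "dist (f t y) (g y) < e" using elim by (simp add: dist_norm)
    qed
  qed
qed

text \<open>Variation of parameters. The quotient \<open>U t = F t (F 0)\<^sup>-\<^sup>1\<close> has the derivative
\<open>l F t (\<gamma>' t - \<gamma>' 0) (F 0)\<^sup>-\<^sup>1\<close> along the curve, which shows at once that \<open>F t\<close> tends to \<open>F 0\<close> uniformly. Before
dividing by \<open>t\<close> one integrates by parts: subtracting \<open>l F t (\<gamma> t - \<gamma> 0) (F 0)\<^sup>-\<^sup>1\<close> from \<open>U t\<close> leaves a
derivative that involves the undifferentiated \<open>\<gamma> t - \<gamma> 0\<close>. Thus only the velocity \<open>\<xi>\<close> itself enters, not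
its derivative along the curve, which would require exchanging mixed partial derivatives of the variation.\<close>

lemma frame_derivative:
  fixes F :: "real \<Rightarrow> real \<Rightarrow> complex^2^2" and \<gamma> \<gamma>' :: "real \<Rightarrow> real \<Rightarrow> real^3"
  assumes ab: "a \<le> b"
    and ev: "\<forall>\<^sub>F t in nhds 0. F t a = mat 1 \<and> (\<forall>y\<in>{a..b}. F t y \<in> SU2 \<and>
      (F t has_vector_derivative F t y ** su2 (l *\<^sub>R \<gamma>' t y)) (at y within {a..b}) \<and>
      (\<gamma> t has_vector_derivative \<gamma>' t y) (at y within {a..b}))"
    and cont: "continuous_on {a..b} (\<gamma>' 0)" "continuous_on {a..b} \<xi>"
    and lim': "uniform_limit {a..b} \<gamma>' (\<gamma>' 0) (at 0)"
    and lim: "uniform_limit {a..b} (\<lambda>t y. (\<gamma> t y - \<gamma> 0 y) /\<^sub>R t) \<xi> (at 0)"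
  shows "((\<lambda>t. (F t b ** adjoint_mat (F 0 b) - mat 1) /\<^sub>R t) \<longlongrightarrow>
    su2 (l *\<^sub>R (Ad (F 0 b) (\<xi> b) - \<xi> a)
      - l\<^sup>2 *\<^sub>R integral {a..b} (\<lambda>y. Ad (F 0 y) (cross3 (\<gamma>' 0 y) (\<xi> y))))) (at 0)"
proof -
  let ?I = "{a..b}"
  have F0: "F 0 a = mat 1" and S0: "y \<in> ?I \<Longrightarrow> F 0 y \<in> SU2"
    and dF0: "y \<in> ?I \<Longrightarrow> (F 0 has_vector_derivative F 0 y ** su2 (l *\<^sub>R \<gamma>' 0 y)) (at y within ?I)"
    and d0: "y \<in> ?I \<Longrightarrow> (\<gamma> 0 has_vector_derivative \<gamma>' 0 y) (at y within ?I)" for y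
    using eventually_nhds_x_imp_x[OF ev] by auto
  have cF0: "continuous_on ?I (F 0)"
    by (rule continuous_on_vector_derivative) (use dF0 in blast)
  have cF0a: "continuous_on ?I (\<lambda>y. adjoint_mat (F 0 y))"
    by (rule bounded_linear.continuous_on[OF bounded_linear_adjoint_mat cF0])
  have bdd: "bounded (h ` ?I)" if "continuous_on ?I h" for h :: "real \<Rightarrow> 'b::real_normed_vector"
    using compact_imp_bounded[OF compact_continuous_image[OF that]] by simp
  have dFa: "((\<lambda>y. adjoint_mat (F 0 y)) has_vector_derivative - (su2 (l *\<^sub>R \<gamma>' 0 y) ** adjoint_mat (F 0 y)))
      (at y within ?I)" if "y \<in> ?I" for y
    using bounded_linear.has_vector_derivative[OF bounded_linear_adjoint_mat dF0[OF that]]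
    by (simp add: adjoint_mat_mult adjoint_su2 matmul.minus_left)
  have ev0: "\<forall>\<^sub>F t in at 0. t \<noteq> 0 \<and> F t a = mat 1 \<and> (\<forall>y\<in>?I. F t y \<in> SU2 \<and>
      (F t has_vector_derivative F t y ** su2 (l *\<^sub>R \<gamma>' t y)) (at y within ?I) \<and>
      (\<gamma> t has_vector_derivative \<gamma>' t y) (at y within ?I))"
    using ev by (auto simp: eventually_at_filter elim: eventually_mono)
  define U where "U t y = F t y ** adjoint_mat (F 0 y)" for t y
  have dU: "(U t has_vector_derivative F t y ** su2 (l *\<^sub>R (\<gamma>' t y - \<gamma>' 0 y)) ** adjoint_mat (F 0 y)) (at y within ?I)"
    if "(F t has_vector_derivative F t y ** su2 (l *\<^sub>R \<gamma>' t y)) (at y within ?I)" "y \<in> ?I" for t y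
    using matmul.has_vector_derivative[OF that(1) dFa[OF that(2)]] unfolding U_def
    by (rule has_vector_derivative_eq_rhs)
      (simp add: su2_linear scaleR_diff_right matmul.diff_left matmul.diff_right matmul.minus_right matrix_mul_assoc)
  \<comment> \<open>The group being bounded, the size of the derivative of \<open>U t\<close> is controlled by \<open>\<gamma>' t - \<gamma>' 0\<close> alone.\<close>
  obtain M where M: "\<And>X. X \<in> SU2 \<Longrightarrow> norm X \<le> M" using bounded_SU2 unfolding bounded_iff by blast
  have M0: "M \<ge> 0" using M[OF mat_1_in_SU2] norm_ge_zero order_trans by blast
  obtain K where K: "K > 0" "\<And>(X :: complex^2^2) (Z :: complex^2^2). norm (X ** Z) \<le> norm X * norm Z * K"
    using matmul.pos_bounded by metis
  obtain L where L: "L > 0" "\<And>v. norm (su2 v) \<le> norm v * L"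
    using bounded_linear.pos_bounded[OF bounded_linear_su2] by metis
  have "uniform_limit ?I (\<lambda>t y. F t y ** su2 (l *\<^sub>R (\<gamma>' t y - \<gamma>' 0 y)) ** adjoint_mat (F 0 y)) (\<lambda>_. 0) (at 0)"
  proof (rule uniform_limit_null_comparison)
    show "\<forall>\<^sub>F t in at 0. \<forall>y\<in>?I. norm (F t y ** su2 (l *\<^sub>R (\<gamma>' t y - \<gamma>' 0 y)) ** adjoint_mat (F 0 y))
        \<le> (M * L * \<bar>l\<bar> * K * M * K) * norm (\<gamma>' t y - \<gamma>' 0 y)"
      using ev0
    proof eventually_elim
      case (elim t)
      show ?case
      proof
        fix y assume y: "y \<in> ?I"
        let ?V = "su2 (l *\<^sub>R (\<gamma>' t y - \<gamma>' 0 y))"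
        have V: "norm ?V \<le> \<bar>l\<bar> * norm (\<gamma>' t y - \<gamma>' 0 y) * L" using L(2)[of "l *\<^sub>R (\<gamma>' t y - \<gamma>' 0 y)"] by simp
        have "norm (F t y ** ?V ** adjoint_mat (F 0 y)) \<le> norm (F t y ** ?V) * norm (adjoint_mat (F 0 y)) * K"
          by (rule K(2))
        also have "\<dots> \<le> (norm (F t y) * norm ?V * K) * M * K"
          using K M0 M[OF adjoint_SU2[OF S0[OF y]]] by (intro mult_mono) auto
        also have "\<dots> \<le> (M * (\<bar>l\<bar> * norm (\<gamma>' t y - \<gamma>' 0 y) * L) * K) * M * K"
          using K M M0 L elim y V by (intro mult_right_mono mult_mono) auto
        finally show "norm (F t y ** ?V ** adjoint_mat (F 0 y)) \<le> (M * L * \<bar>l\<bar> * K * M * K) * norm (\<gamma>' t y - \<gamma>' 0 y)"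
          by (simp add: ac_simps)
      qed
    qed
    have "uniform_limit ?I (\<lambda>t y. norm (\<gamma>' t y - \<gamma>' 0 y)) (\<lambda>y. norm (\<gamma>' 0 y - \<gamma>' 0 y)) (at 0)"
      by (intro uniform_limit_norm uniform_limit_minus lim' uniform_limit_const)
    from bounded_linear.uniform_limit[OF bounded_linear_mult_right this]
    show "uniform_limit ?I (\<lambda>t y. (M * L * \<bar>l\<bar> * K * M * K) * norm (\<gamma>' t y - \<gamma>' 0 y)) (\<lambda>_. 0) (at 0)" by simp
  qed
  then have limU: "uniform_limit ?I U (\<lambda>_. mat 1) (at 0)"
  proof (rule uniform_limit_of_derivatives[rotated 2])
    show "\<forall>\<^sub>F t in at 0. \<forall>y\<in>?I. (U t has_vector_derivative
        F t y ** su2 (l *\<^sub>R (\<gamma>' t y - \<gamma>' 0 y)) ** adjoint_mat (F 0 y)) (at y within ?I)"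
      using ev0 by eventually_elim (use dU in blast)
    show "((\<lambda>t. U t a) \<longlongrightarrow> mat 1) (at 0)"
      by (rule tendsto_eventually) (use ev0 in eventually_elim, simp add: U_def F0 adjoint_mat_1)
  qed simp
  have limF: "uniform_limit ?I F (F 0) (at 0)"
  proof -
    have "uniform_limit ?I (\<lambda>t y. U t y ** F 0 y) (\<lambda>y. mat 1 ** F 0 y) (at 0)"
      by (intro matmul.bounded_uniform_limit limU uniform_limit_const bdd cF0 continuous_on_const)
    then show ?thesis
      by (rule uniform_limit_cong'[THEN iffD1, rotated 2])
        (auto simp: U_def matrix_mul_assoc[symmetric] SU2_inv S0)
  qed
  define q where "q t y = (\<gamma> t y - \<gamma> 0 y) /\<^sub>R t" for t y
  \<comment> \<open>The integrated-by-parts quotient \<open>f\<close>, its derivative \<open>f'\<close>, and their limits \<open>g\<close>, \<open>g'\<close>. The constant in \<open>g\<close> is the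
    limit of the boundary term at \<open>a\<close>.\<close>
  define f where "f t y = (U t y - mat 1) /\<^sub>R t - l *\<^sub>R (F t y ** su2 (q t y) ** adjoint_mat (F 0 y))" for t y
  define f' where "f' t y = (- l\<^sup>2) *\<^sub>R (F t y ** (su2 (\<gamma>' t y) ** su2 (q t y) - su2 (q t y) ** su2 (\<gamma>' 0 y))
    ** adjoint_mat (F 0 y))" for t y
  define w where "w y = Ad (F 0 y) (cross3 (\<gamma>' 0 y) (\<xi> y))" for y
  define g where "g y = su2 (- l *\<^sub>R \<xi> a - l\<^sup>2 *\<^sub>R integral {a..y} w)" for y
  define g' where "g' y = (- l\<^sup>2) *\<^sub>R (F 0 y ** (su2 (\<gamma>' 0 y) ** su2 (\<xi> y) - su2 (\<xi> y) ** su2 (\<gamma>' 0 y))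
    ** adjoint_mat (F 0 y))" for y
  note csu2 = bounded_linear.continuous_on[OF bounded_linear_su2]
  have "uniform_limit ?I f g (at 0)"
  proof (rule uniform_limit_of_derivatives)
    show "\<forall>\<^sub>F t in at 0. \<forall>y\<in>?I. (f t has_vector_derivative f' t y) (at y within ?I)"
      using ev0
    proof eventually_elim
      case (elim t)
      show ?case
      proof
        fix y assume y: "y \<in> ?I"
        have dF: "(F t has_vector_derivative F t y ** su2 (l *\<^sub>R \<gamma>' t y)) (at y within ?I)"
          and d: "(\<gamma> t has_vector_derivative \<gamma>' t y) (at y within ?I)" using elim y by auto
        have dq: "((\<lambda>y. su2 (q t y)) has_vector_derivative su2 ((\<gamma>' t y - \<gamma>' 0 y) /\<^sub>R t)) (at y within ?I)"
          unfolding q_def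
          by (intro bounded_linear.has_vector_derivative[OF bounded_linear_su2] 
              bounded_linear.has_vector_derivative[OF bounded_linear_scaleR_right]
              has_vector_derivative_diff d d0 y)
        have "(f t has_vector_derivative
          (F t y ** su2 (l *\<^sub>R (\<gamma>' t y - \<gamma>' 0 y)) ** adjoint_mat (F 0 y) - 0) /\<^sub>R t -
          l *\<^sub>R ((F t y ** su2 (q t y)) ** - (su2 (l *\<^sub>R \<gamma>' 0 y) ** adjoint_mat (F 0 y)) +
           (F t y ** su2 ((\<gamma>' t y - \<gamma>' 0 y) /\<^sub>R t) + F t y ** su2 (l *\<^sub>R \<gamma>' t y) ** su2 (q t y)) ** adjoint_mat (F 0 y)))
          (at y within ?I)"
          unfolding f_def
          by (intro has_vector_derivative_diff bounded_linear.has_vector_derivative[OF bounded_linear_scaleR_right]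
              dU dF y has_vector_derivative_const matmul.has_vector_derivative dFa dq)
        \<comment> \<open>The terms with \<open>\<gamma>' t - \<gamma>' 0\<close> cancel here.\<close>
        then show "(f t has_vector_derivative f' t y) (at y within ?I)"
          by (rule has_vector_derivative_eq_rhs)
           (simp add: f'_def su2_linear matmul.diff_left matmul.diff_right matmul.add_left matmul.minus_right
              matmul.scaleR_left matmul.scaleR_right matrix_mul_assoc power2_eq_square algebra_simps)
      qed
    qed
    show "(g has_vector_derivative g' y) (at y within ?I)" if y: "y \<in> ?I" for y
    proof -
      have cw: "continuous_on ?I w"
        unfolding w_def by (intro continuous_on_Ad cF0 cross.continuous_on cont S0)
      have "(g has_vector_derivative su2 (0 - l\<^sup>2 *\<^sub>R w y)) (at y within ?I)"
        unfolding g_def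
        by (intro bounded_linear.has_vector_derivative[OF bounded_linear_su2] 
              bounded_linear.has_vector_derivative[OF bounded_linear_scaleR_right]
              has_vector_derivative_diff has_vector_derivative_const integral_has_vector_derivative cw y)
      then show ?thesis
        by (rule has_vector_derivative_eq_rhs)
          (simp add: g'_def w_def su2_Ad[OF S0[OF y]] su2_cross[symmetric] su2_linear)
    qed
    show "uniform_limit ?I f' g' (at 0)"
      unfolding f'_def g'_def
      by (intro bounded_linear.uniform_limit[OF bounded_linear_scaleR_right] matmul.bounded_uniform_limit
          uniform_limit_minus bounded_linear.uniform_limit[OF bounded_linear_su2] limF lim' lim[folded q_def]
          uniform_limit_const bdd matmul.continuous_on continuous_on_diff csu2 cont cF0 cF0a)
    show "((\<lambda>t. f t a) \<longlongrightarrow> g a) (at 0)"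
    proof -
      have "((\<lambda>t. q t a) \<longlongrightarrow> \<xi> a) (at 0)"
        using tendsto_uniform_limitI[OF lim[folded q_def]] ab by simp
      then have lim_a: "((\<lambda>t. - (l *\<^sub>R su2 (q t a))) \<longlongrightarrow> - (l *\<^sub>R su2 (\<xi> a))) (at 0)"
        by (intro tendsto_intros bounded_linear.tendsto[OF bounded_linear_su2])
      have eq_a: "\<forall>\<^sub>F t in at 0. - (l *\<^sub>R su2 (q t a)) = f t a"
        using ev0 by eventually_elim (simp add: f_def U_def F0 adjoint_mat_1)
      have "g a = - (l *\<^sub>R su2 (\<xi> a))" by (simp add: g_def su2_linear)
      then show ?thesis using Lim_transform_eventually[OF lim_a eq_a] by simp
    qed
  qed
  then have "((\<lambda>t. f t b) \<longlongrightarrow> g b) (at 0)" using ab by (auto dest: tendsto_uniform_limitI)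
  moreover have "((\<lambda>t. l *\<^sub>R (F t b ** su2 (q t b) ** adjoint_mat (F 0 b))) \<longlongrightarrow>
      l *\<^sub>R (F 0 b ** su2 (\<xi> b) ** adjoint_mat (F 0 b))) (at 0)"
    using tendsto_uniform_limitI[OF lim[folded q_def], of b] tendsto_uniform_limitI[OF limF, of b] ab
    by (intro tendsto_intros matmul.tendsto bounded_linear.tendsto[OF bounded_linear_su2]) auto
  ultimately have "((\<lambda>t. f t b + l *\<^sub>R (F t b ** su2 (q t b) ** adjoint_mat (F 0 b))) \<longlongrightarrow>
      g b + l *\<^sub>R (F 0 b ** su2 (\<xi> b) ** adjoint_mat (F 0 b))) (at 0)"
    by (rule tendsto_add)
  moreover have "g b + l *\<^sub>R (F 0 b ** su2 (\<xi> b) ** adjoint_mat (F 0 b)) =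
      su2 (l *\<^sub>R (Ad (F 0 b) (\<xi> b) - \<xi> a) - l\<^sup>2 *\<^sub>R integral ?I w)"
    using ab by (simp add: g_def su2_linear su2_Ad[symmetric] S0 algebra_simps)
  ultimately show ?thesis by (simp add: f_def U_def w_def[abs_def])
qed

section \<open>Uniform limits along a variation\<close>

text \<open>The limits at \<open>t = 0\<close> below rest on the joint continuity of the two first partial derivatives on a strip; they are
the values of the Frechet derivative of the variation on the coordinate directions.\<close>

lemma variation_regularity:
  assumes "variation \<tau> A a \<gamma> g"
  obtains \<epsilon> h where "\<epsilon> > 0"
    and "\<And>t. \<bar>t\<bar> < \<epsilon> \<Longrightarrow> g t \<in> curves \<tau> A a"
    and "\<And>t y. \<bar>t\<bar> < \<epsilon> \<Longrightarrow> ((\<lambda>t. g t y) has_vector_derivative h t y) (at t)"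
    and "continuous_on ({- \<epsilon><..<\<epsilon>} \<times> UNIV) (\<lambda>(t, y). h t y)"
    and "continuous_on ({- \<epsilon><..<\<epsilon>} \<times> UNIV) (\<lambda>(t, y). vector_derivative (g t) (at y))"
proof -
  define G where "G p = g (fst p) (snd p)" for p
  from assms obtain \<epsilon> where \<epsilon>: "\<epsilon> > 0" and smooth: "smooth_on {p. \<bar>fst p\<bar> < \<epsilon>} G"
    and curves: "\<And>t. \<bar>t\<bar> < \<epsilon> \<Longrightarrow> g t \<in> curves \<tau> A a"
    unfolding variation_def G_def[abs_def] by blast
  define D where "D v p = frechet_derivative G (at p) v" for v p
  have S: "{p :: real \<times> real. \<bar>fst p\<bar> < \<epsilon>} = {- \<epsilon><..<\<epsilon>} \<times> UNIV" by (auto simp: abs_less_iff)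
  have "Ck_on (Suc 0) {p. \<bar>fst p\<bar> < \<epsilon>} G" using smooth unfolding smooth_on_def by blast
  then have diff: "\<And>p. \<bar>fst p\<bar> < \<epsilon> \<Longrightarrow> G differentiable (at p)"
    and cont: "\<And>v. continuous_on ({- \<epsilon><..<\<epsilon>} \<times> UNIV) (D v)"
    by (auto simp: D_def[abs_def] S[symmetric])
  have der: "(G has_derivative (\<lambda>v. D v p)) (at p)" if "\<bar>fst p\<bar> < \<epsilon>" for p
    using diff[OF that] by (simp add: D_def frechet_derivative_works[symmetric])
  have dt: "((\<lambda>t. g t y) has_vector_derivative D (1, 0) (t, y)) (at t)" if "\<bar>t\<bar> < \<epsilon>" for t y
  proof -
    have "((\<lambda>t. (t, y)) has_vector_derivative (1, 0)) (at t)"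
      by (intro has_vector_derivative_Pair) (auto intro: derivative_eq_intros)
    moreover have "(G has_derivative (\<lambda>v. D v (t, y))) (at (t, y) within range (\<lambda>t. (t, y)))"
      using der[of "(t, y)"] that by (auto intro: has_derivative_at_withinI)
    ultimately have "(G \<circ> (\<lambda>t. (t, y)) has_vector_derivative D (1, 0) (t, y)) (at t)"
      by (rule vector_derivative_diff_chain_within)
    then show ?thesis by (simp add: G_def o_def)
  qed
  have dy: "vector_derivative (g t) (at y) = D (0, 1) (t, y)" if "\<bar>t\<bar> < \<epsilon>" for t y
  proof -
    have "((\<lambda>y. (t, y)) has_vector_derivative (0, 1)) (at y)"
      by (intro has_vector_derivative_Pair) (auto intro: derivative_eq_intros)
    moreover have "(G has_derivative (\<lambda>v. D v (t, y))) (at (t, y) within range (\<lambda>y. (t, y)))"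
      using der[of "(t, y)"] that by (auto intro: has_derivative_at_withinI)
    ultimately have "(G \<circ> (\<lambda>y. (t, y)) has_vector_derivative D (0, 1) (t, y)) (at y)"
      by (rule vector_derivative_diff_chain_within)
    then show ?thesis by (intro vector_derivative_at) (simp add: G_def o_def)
  qed
  have "continuous_on ({- \<epsilon><..<\<epsilon>} \<times> UNIV) (\<lambda>(t, y). vector_derivative (g t) (at y))"
    by (rule continuous_on_cong[THEN iffD1, OF refl _ cont[of "(0, 1)"]]) (auto simp: dy abs_less_iff)
  then show ?thesis
    using that[of \<epsilon> "\<lambda>t y. D (1, 0) (t, y)"] \<epsilon> curves dt cont[of "(1, 0)"] by (simp add: case_prod_beta')
qed

text \<open>A continuous function on the strip is uniformly continuous at \<open>t = 0\<close> over a compact interval.\<close>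

lemma uniform_limit_slice:
  fixes k :: "real \<Rightarrow> real \<Rightarrow> 'b::real_normed_vector"
  assumes "continuous_on ({- \<epsilon><..<\<epsilon>} \<times> UNIV) (\<lambda>(t, y). k t y)" "\<epsilon> > 0"
  shows "uniform_limit {p..q} k (k 0) (nhds 0)"
proof (rule uniform_limitI)
  fix e :: real assume e: "e > 0"
  have cont: "continuous_on ({- \<epsilon><..<\<epsilon>} \<times> {p..q}) (\<lambda>(t, y). k t y)"
    by (rule continuous_on_subset[OF assms(1)]) auto
  have zero: "0 \<in> {- \<epsilon><..<\<epsilon>}" and half: "e / 2 > 0" using assms(2) e by auto
  from continuous_on_prod_compactE[OF cont compact_Icc zero half]
  obtain X where X: "0 \<in> X" "open X"
    and le: "\<And>t y. t \<in> X \<inter> {- \<epsilon><..<\<epsilon>} \<Longrightarrow> y \<in> {p..q} \<Longrightarrow> dist (k t y) (k 0 y) \<le> e / 2"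
    unfolding prod.case by metis
  have "\<forall>\<^sub>F t in nhds 0. t \<in> X \<inter> {- \<epsilon><..<\<epsilon>}"
    using X assms(2) by (intro eventually_nhds_in_open) auto
  then show "\<forall>\<^sub>F t in nhds 0. \<forall>y\<in>{p..q}. dist (k t y) (k 0 y) < e"
  proof eventually_elim
    case (elim t)
    have "e / 2 < e" using e by simp
    with le[OF elim] show ?case by (blast intro: le_less_trans)
  qed
qed

lemma uniform_limit_difference_quotient:
  fixes g h :: "real \<Rightarrow> real \<Rightarrow> 'b::real_normed_vector"
  assumes dg: "\<And>t y. \<bar>t\<bar> < \<epsilon> \<Longrightarrow> ((\<lambda>t. g t y) has_vector_derivative h t y) (at t)"
    and h: "continuous_on ({- \<epsilon><..<\<epsilon>} \<times> UNIV) (\<lambda>(t, y). h t y)" and \<epsilon>: "\<epsilon> > 0"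
  shows "uniform_limit {p..q} (\<lambda>t y. (g t y - g 0 y) /\<^sub>R t) (h 0) (at 0)"
proof (rule uniform_limitI)
  fix e :: real assume e: "e > 0"
  have "\<forall>\<^sub>F t in nhds 0. \<forall>y\<in>{p..q}. dist (h t y) (h 0 y) < e / 2"
    using uniform_limitD[OF uniform_limit_slice[OF h \<epsilon>], of "e / 2"] e by simp
  then obtain d where d: "d > 0" "\<And>t y. \<bar>t\<bar> < d \<Longrightarrow> y \<in> {p..q} \<Longrightarrow> dist (h t y) (h 0 y) < e / 2"
    unfolding eventually_nhds_metric by (auto simp: dist_real_def)
  have "dist ((g t y - g 0 y) /\<^sub>R t) (h 0 y) < e"
    if t: "t \<noteq> 0" "\<bar>t\<bar> < min d \<epsilon>" and y: "y \<in> {p..q}" for t y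
  proof -
    have seg: "\<bar>s\<bar> < min d \<epsilon>" if "s \<in> closed_segment 0 t" for s
      using that t by (auto simp: closed_segment_eq_real_ivl split: if_splits)
    have "norm (g t y - g 0 y - (t - 0) *\<^sub>R h 0 y) \<le> norm (t - 0) * (e / 2)"
    proof (rule vector_differentiable_bound_linearization[where S="closed_segment 0 t" and f'="\<lambda>s. h s y"])
      show "((\<lambda>t. g t y) has_vector_derivative h s y) (at s within closed_segment 0 t)"
        if "s \<in> closed_segment 0 t" for s
        using dg[of s y] seg[OF that] by (auto intro: has_vector_derivative_at_within)
      show "norm (h s y - h 0 y) \<le> e / 2" if "s \<in> closed_segment 0 t" for s
        using d(2)[OF _ y, of s] seg[OF that] by (simp add: dist_norm less_imp_le)
    qed auto
    then have "norm ((g t y - g 0 y - t *\<^sub>R h 0 y) /\<^sub>R t) \<le> e / 2"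
      unfolding norm_scaleR using t by (simp add: inverse_eq_divide pos_divide_le_eq mult.commute)
    moreover have "(g t y - g 0 y) /\<^sub>R t - h 0 y = (g t y - g 0 y - t *\<^sub>R h 0 y) /\<^sub>R t"
      using t by (simp add: scaleR_diff_right)
    ultimately show ?thesis using e unfolding dist_norm by simp
  qed
  then show "\<forall>\<^sub>F t in at 0. \<forall>y\<in>{p..q}. dist ((g t y - g 0 y) /\<^sub>R t) (h 0 y) < e"
    unfolding eventually_at using d(1) \<epsilon> by (intro exI[of _ "min d \<epsilon>"]) (auto simp: dist_real_def)
qed

lemma variation_limits:
  assumes var: "variation \<tau> A a \<gamma> g" and A: "A \<in> SU2"
  shows variation_in_curves: "\<forall>\<^sub>F t in nhds 0. g t \<in> curves \<tau> A a"
    and variation_quotient: "uniform_limit {p..q} (\<lambda>t y. (g t y - g 0 y) /\<^sub>R t) (velocity g) (at 0)"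
    and variation_tangent: "uniform_limit {p..q} (\<lambda>t y. vector_derivative (g t) (at y))
      (\<lambda>y. vector_derivative (g 0) (at y)) (at 0)"
    and continuous_velocity: "continuous_on S (velocity g)"
    and velocity_equivariant: "velocity g (\<tau> x) = Ad A (velocity g x)"
proof -
  obtain \<epsilon> h where \<epsilon>: "\<epsilon> > 0" and curves: "\<And>t. \<bar>t\<bar> < \<epsilon> \<Longrightarrow> g t \<in> curves \<tau> A a"
    and dg: "\<And>t y. \<bar>t\<bar> < \<epsilon> \<Longrightarrow> ((\<lambda>t. g t y) has_vector_derivative h t y) (at t)"
    and h: "continuous_on ({- \<epsilon><..<\<epsilon>} \<times> UNIV) (\<lambda>(t, y). h t y)"
    and g': "continuous_on ({- \<epsilon><..<\<epsilon>} \<times> UNIV) (\<lambda>(t, y). vector_derivative (g t) (at y))"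
    using variation_regularity[OF var] by metis
  have v: "velocity g = h 0"
    using dg[of 0] \<epsilon> by (auto simp: velocity_def fun_eq_iff intro: vector_derivative_at)
  have "\<forall>\<^sub>F t in nhds 0. t \<in> {- \<epsilon><..<\<epsilon>}" using \<epsilon> by (intro eventually_nhds_in_open) auto
  then show "\<forall>\<^sub>F t in nhds 0. g t \<in> curves \<tau> A a" by eventually_elim (auto intro: curves)
  show "uniform_limit {p..q} (\<lambda>t y. (g t y - g 0 y) /\<^sub>R t) (velocity g) (at 0)"
    unfolding v by (rule uniform_limit_difference_quotient[OF dg h \<epsilon>])
  show "uniform_limit {p..q} (\<lambda>t y. vector_derivative (g t) (at y)) (\<lambda>y. vector_derivative (g 0) (at y)) (at 0)"
    using uniform_limit_slice[OF g' \<epsilon>] filterlim_mono[OF _ order_refl] by (auto simp: at_within_def intro: filterlim_mono inf_le1)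
  have "continuous_on UNIV (\<lambda>y. (\<lambda>(t, y). h t y) (0, y))"
    by (rule continuous_on_compose2[OF h]) (use \<epsilon> in \<open>auto intro!: continuous_intros\<close>)
  then show "continuous_on S (velocity g)" unfolding v by (auto intro: continuous_on_subset)
  have "((\<lambda>t. Ad A (g t x) + a) has_vector_derivative Ad A (h 0 x)) (at 0)"
    using bounded_linear.has_vector_derivative[OF linear_Ad[OF A] dg[of 0 x]] \<epsilon>
    by (simp add: has_vector_derivative_add_const)
  then have "((\<lambda>t. g t (\<tau> x)) has_vector_derivative Ad A (h 0 x)) (at 0)"
    by (rule has_vector_derivative_transform_within_open[where S="{- \<epsilon><..<\<epsilon>}"])
      (use \<epsilon> curves in \<open>auto simp: curves_def abs_less_iff\<close>)
  then show "velocity g (\<tau> x) = Ad A (velocity g x)"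
    unfolding v using dg[of 0 "\<tau> x"] \<epsilon> vector_derivative_unique_at by force
qed

section \<open>The axis field as a tangent vector\<close>

text \<open>The factor \<open>v\<close> arises because \<open>Ck_on\<close> quantifies over the directions of the Frechet derivative, and on
the real line a direction is a scalar.\<close>

lemma Ck_on_UNIV_SucI:
  fixes f :: "real \<Rightarrow> 'b::real_normed_vector"
  assumes "\<And>x. (f has_vector_derivative f' x) (at x)" "\<And>v. Ck_on k UNIV (\<lambda>x. v *\<^sub>R f' x)"
  shows "Ck_on (Suc k) UNIV f"
proof -
  have "frechet_derivative f (at x) = (\<lambda>v. v *\<^sub>R f' x)" for x
    using assms(1)[of x] frechet_derivative_at unfolding has_vector_derivative_def by metis
  then show ?thesis
    using assms by (auto simp: has_vector_derivative_def differentiable_def)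
qed

lemma Ck_on_UNIV_SucD:
  fixes f :: "real \<Rightarrow> 'b::real_normed_vector"
  assumes "Ck_on (Suc k) UNIV f"
  shows "(f has_vector_derivative vector_derivative f (at x)) (at x)"
    and "Ck_on k UNIV (\<lambda>x. vector_derivative f (at x))"
proof -
  show d: "(f has_vector_derivative vector_derivative f (at x)) (at x)" for x
    using assms by (simp add: vector_derivative_works[symmetric])
  have "vector_derivative f (at x) = frechet_derivative f (at x) 1" for x
    using d[of x] frechet_derivative_at[of f] unfolding has_vector_derivative_def by (metis scaleR_one)
  then show "Ck_on k UNIV (\<lambda>x. vector_derivative f (at x))" using assms by simp
qed

lemma Ck_on_UNIV_continuous:
  fixes f :: "real \<Rightarrow> 'b::real_normed_vector"
  assumes "Ck_on k UNIV f"
  shows "continuous_on UNIV f"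
  using assms
  by (cases k) (auto simp: differentiable_imp_continuous_within continuous_on_eq_continuous_within)

lemma Ck_on_UNIV_add:
  fixes f g :: "real \<Rightarrow> 'b::real_normed_vector"
  assumes "Ck_on k UNIV f" "Ck_on k UNIV g"
  shows "Ck_on k UNIV (\<lambda>x. f x + g x)"
  using assms
proof (induction k arbitrary: f g)
  case 0
  then show ?case by (auto intro: continuous_on_add)
next
  case (Suc k)
  have "frechet_derivative (\<lambda>x. f x + g x) (at x) v = frechet_derivative f (at x) v + frechet_derivative g (at x) v" for x v
  proof -
    have "((\<lambda>x. f x + g x) has_derivative (\<lambda>v. frechet_derivative f (at x) v + frechet_derivative g (at x) v)) (at x)"
      using Suc.prems by (intro has_derivative_add) (auto simp: frechet_derivative_works[symmetric])
    then show ?thesis by (metis frechet_derivative_at)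
  qed
  then show ?case using Suc by (auto intro: differentiable_add)
qed

lemma Ck_on_UNIV_lower:
  fixes f :: "real \<Rightarrow> 'b::real_normed_vector"
  assumes "Ck_on (Suc k) UNIV f"
  shows "Ck_on k UNIV f"
  using assms
proof (induction k arbitrary: f)
  case 0
  then show ?case using Ck_on_UNIV_continuous[of "Suc 0" f] by simp
next
  case (Suc k)
  then show ?case by simp
qed

lemma Ck_on_UNIV_linear:
  fixes f :: "real \<Rightarrow> 'b::real_normed_vector"
  assumes L: "bounded_linear L" and "Ck_on k UNIV f"
  shows "Ck_on k UNIV (\<lambda>x. L (f x))"
  using assms(2)
proof (induction k arbitrary: f)
  case 0
  then show ?case by (auto intro: bounded_linear.continuous_on[OF L])
next
  case (Suc k)
  have "((\<lambda>x. L (f x)) has_derivative (\<lambda>v. L (frechet_derivative f (at x) v))) (at x)" for x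
    using Suc.prems by (intro bounded_linear.has_derivative[OF L]) (auto simp: frechet_derivative_works[symmetric])
  moreover from this have "frechet_derivative (\<lambda>x. L (f x)) (at x) v = L (frechet_derivative f (at x) v)" for x v
    by (metis frechet_derivative_at)
  ultimately show ?case using Suc by (auto simp: differentiable_def)
qed

lemma Ck_on_UNIV_bilinear:
  fixes f :: "real \<Rightarrow> 'b::real_normed_vector" and g :: "real \<Rightarrow> 'c::real_normed_vector"
  assumes P: "bounded_bilinear P" and "Ck_on k UNIV f" "Ck_on k UNIV g"
  shows "Ck_on k UNIV (\<lambda>x. P (f x) (g x))"
  using assms(2,3)
proof (induction k arbitrary: f g)
  case 0
  then show ?case by (auto intro: bounded_bilinear.continuous_on[OF P])
next
  case (Suc k)
  note f = Ck_on_UNIV_SucD[OF Suc.prems(1)] and g = Ck_on_UNIV_SucD[OF Suc.prems(2)]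
  show ?case
    by (rule Ck_on_UNIV_SucI[OF bounded_bilinear.has_vector_derivative[OF P f(1) g(1)]])
      (intro Ck_on_UNIV_linear[OF bounded_linear_scaleR_right] Ck_on_UNIV_add Suc.IH f g
        Ck_on_UNIV_lower[OF Suc.prems(1)] Ck_on_UNIV_lower[OF Suc.prems(2)])
qed

lemma curve_derivative:
  assumes "\<gamma> \<in> curves \<tau> A a"
  shows "(\<gamma> has_vector_derivative vector_derivative \<gamma> (at x)) (at x)"
    and "Ck_on k UNIV (\<lambda>x. vector_derivative \<gamma> (at x))"
    and "speed \<gamma> x > 0"
    and "speed \<gamma> x *\<^sub>R unit_tangent \<gamma> x = vector_derivative \<gamma> (at x)"
proof -
  have "Ck_on (Suc k) UNIV \<gamma>" for k using assms by (simp add: curves_def smooth_on_def del: Ck_on.simps)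
  from Ck_on_UNIV_SucD[OF this]
  show "(\<gamma> has_vector_derivative vector_derivative \<gamma> (at x)) (at x)"
    and "Ck_on k UNIV (\<lambda>x. vector_derivative \<gamma> (at x))" by blast+
  show s: "speed \<gamma> x > 0" using assms by (simp add: curves_def speed_def)
  then show "speed \<gamma> x *\<^sub>R unit_tangent \<gamma> x = vector_derivative \<gamma> (at x)"
    by (simp add: unit_tangent_def arc_derivative_def)
qed

lemma frame_ode:
  assumes "\<gamma> \<in> curves \<tau> A a" "is_frame x0 \<gamma> l F"
  shows "F x \<in> SU2"
    and "(F has_vector_derivative F x ** su2 (l *\<^sub>R vector_derivative \<gamma> (at x))) (at x)"
proof -
  show "F x \<in> SU2" using assms by (simp add: is_frame_def)
  have "(F has_vector_derivative speed \<gamma> x *\<^sub>R (F x ** su2 (l *\<^sub>R unit_tangent \<gamma> x))) (at x)"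
    using assms(2) has_vector_derivative_arc_derivative[OF _ curve_derivative(3)[OF assms(1)], of F]
    by (auto simp: is_frame_def)
  then show "(F has_vector_derivative F x ** su2 (l *\<^sub>R vector_derivative \<gamma> (at x))) (at x)"
    by (simp add: curve_derivative(4)[OF assms(1), symmetric] su2_linear matmul.scaleR_right ac_simps)
qed

lemma axis_field_eq:
  assumes "F x \<in> SU2"
  shows "axis_field F y x = Ad (adjoint_mat (F x)) y"
  using SU2_inv[OF assms] by (simp add: axis_field_def)

text \<open>The field is \<open>F\<^sup>-\<^sup>1 y F\<close> as a matrix, so differentiating it produces the commutator with \<open>l T\<close>.\<close>

lemma axis_field_ode:
  assumes "\<gamma> \<in> curves \<tau> A a" "is_frame x0 \<gamma> l F"
  shows "(axis_field F y has_vector_derivative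
    l *\<^sub>R cross3 (axis_field F y x) (vector_derivative \<gamma> (at x))) (at x)"
proof (rule has_vector_derivative_su2D)
  note F = frame_ode[OF assms]
  let ?V = "su2 (l *\<^sub>R vector_derivative \<gamma> (at x))"
  have Y: "su2 (axis_field F y x) = adjoint_mat (F x) ** su2 y ** F x" for x
    by (simp add: axis_field_eq F su2_Ad adjoint_SU2)
  have "((\<lambda>x. adjoint_mat (F x)) has_vector_derivative - (?V ** adjoint_mat (F x))) (at x)"
    using bounded_linear.has_vector_derivative[OF bounded_linear_adjoint_mat F(2)]
    by (simp add: adjoint_mat_mult adjoint_su2 matmul.minus_left)
  then have "((\<lambda>x. adjoint_mat (F x) ** su2 y ** F x) has_vector_derivative
      adjoint_mat (F x) ** su2 y ** (F x ** ?V) + - (?V ** adjoint_mat (F x)) ** su2 y ** F x) (at x)"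
    by (intro matmul.has_vector_derivative F(2) bounded_linear.has_vector_derivative[OF matmul.bounded_linear_left])
  moreover have "adjoint_mat (F x) ** su2 y ** (F x ** ?V) + - (?V ** adjoint_mat (F x)) ** su2 y ** F x
      = su2 (l *\<^sub>R cross3 (axis_field F y x) (vector_derivative \<gamma> (at x)))"
    by (simp add: cross.scaleR_right[symmetric] su2_cross Y matmul.minus_left matrix_mul_assoc)
  ultimately show "((\<lambda>x. su2 (axis_field F y x)) has_vector_derivative
      su2 (l *\<^sub>R cross3 (axis_field F y x) (vector_derivative \<gamma> (at x)))) (at x)"
    by (simp add: Y)
qed

text \<open>Differentiating \<open>\<gamma> \<circ> \<tau> = Ad A \<gamma> + a\<close>.\<close>

lemma tangent_equivariant:
  assumes \<tau>: "translation \<tau>" and A: "A \<in> SU2" and \<gamma>: "\<gamma> \<in> curves \<tau> A a"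
    and "(\<tau> has_real_derivative d) (at x)"
  shows "d *\<^sub>R vector_derivative \<gamma> (at (\<tau> x)) = Ad A (vector_derivative \<gamma> (at x))"
proof -
  have "((\<lambda>x. \<gamma> (\<tau> x)) has_vector_derivative d *\<^sub>R vector_derivative \<gamma> (at (\<tau> x))) (at x)"
    using vector_diff_chain_at[of \<tau> d x \<gamma>] curve_derivative(1)[OF \<gamma>] assms(4)
    by (simp add: has_real_derivative_iff_has_vector_derivative o_def)
  moreover have "((\<lambda>x. Ad A (\<gamma> x) + a) has_vector_derivative Ad A (vector_derivative \<gamma> (at x))) (at x)"
    using bounded_linear.has_vector_derivative[OF linear_Ad[OF A] curve_derivative(1)[OF \<gamma>]]
    by (simp add: has_vector_derivative_add_const)
  moreover have "(\<lambda>x. \<gamma> (\<tau> x)) = (\<lambda>x. Ad A (\<gamma> x) + a)"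
    using \<gamma> by (simp add: curves_def)
  ultimately show ?thesis by (metis vector_derivative_unique_at)
qed

text \<open>Pulled back by \<open>\<tau>\<close> and rotated back by \<open>A\<close>, the axis field solves the same linear equation as the axis field
itself. The difference \<open>Z\<close> of the two satisfies \<open>Z' = l Z \<times> \<gamma>'\<close>, hence has constant length, and it vanishes
at \<open>x0\<close> because \<open>y\<close> is fixed by the monodromy.\<close>

lemma axis_field_equivariant:
  assumes \<tau>: "translation \<tau>" and A: "A \<in> SU2" and \<gamma>: "\<gamma> \<in> curves \<tau> A a"
    and F: "is_frame x0 \<gamma> l F" and y: "Ad (monodromy \<tau> x0 A F) y = y"
  shows "axis_field F y (\<tau> x) = Ad A (axis_field F y x)"
proof -
  note FS = frame_ode(1)[OF \<gamma> F] and dY = axis_field_ode[OF \<gamma> F, of y]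
  let ?Y = "axis_field F y"
  define Z where "Z x = Ad (adjoint_mat A) (?Y (\<tau> x)) - ?Y x" for x
  have dZ: "(Z has_vector_derivative l *\<^sub>R cross3 (Z x) (vector_derivative \<gamma> (at x))) (at x)" for x
  proof -
    obtain d where d: "(\<tau> has_real_derivative d) (at x)" using translation_deriv[OF \<tau>] by metis
    have "((\<lambda>x. ?Y (\<tau> x)) has_vector_derivative
        d *\<^sub>R (l *\<^sub>R cross3 (?Y (\<tau> x)) (vector_derivative \<gamma> (at (\<tau> x))))) (at x)"
      using vector_diff_chain_at[of \<tau> d x ?Y] dY d
      by (simp add: has_real_derivative_iff_has_vector_derivative o_def del: scaleR_scaleR)
    also have "d *\<^sub>R (l *\<^sub>R cross3 (?Y (\<tau> x)) (vector_derivative \<gamma> (at (\<tau> x)))) =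
        l *\<^sub>R cross3 (?Y (\<tau> x)) (Ad A (vector_derivative \<gamma> (at x)))"
      unfolding tangent_equivariant[OF \<tau> A \<gamma> d, symmetric] by (simp add: cross.scaleR_right)
    finally have "(Z has_vector_derivative
        Ad (adjoint_mat A) (l *\<^sub>R cross3 (?Y (\<tau> x)) (Ad A (vector_derivative \<gamma> (at x))))
        - l *\<^sub>R cross3 (?Y x) (vector_derivative \<gamma> (at x))) (at x)"
      unfolding Z_def
      by (intro has_vector_derivative_diff bounded_linear.has_vector_derivative[OF linear_Ad] adjoint_SU2 A dY)
    then show ?thesis
      by (rule has_vector_derivative_eq_rhs)
        (simp add: Z_def linear_simps[OF linear_Ad[OF adjoint_SU2[OF A]]] Ad_cross3[OF adjoint_SU2[OF A]]
          Ad_adjoint_Ad[OF A] cross.diff_left scaleR_diff_right)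
  qed
  have "((\<lambda>x. Z x \<bullet> Z x) has_vector_derivative 0) (at x)" for x
    using bounded_bilinear.has_vector_derivative[OF bounded_bilinear_inner dZ dZ, of x]
    by (simp add: dot_cross_self)
  then obtain c where c: "\<And>x. Z x \<bullet> Z x = c"
    using has_vector_derivative_zero_constant[of UNIV "\<lambda>x. Z x \<bullet> Z x"] by auto
  have "?Y x0 = y"
    using inj_su2 F by (simp add: axis_field_eq FS) (simp add: is_frame_def, rule injD[OF inj_su2], 
      simp add: su2_Ad adjoint_SU2 mat_1_in_SU2, simp add: adjoint_mat_def mat_def vec_eq_iff forall_2 matrix_matrix_mult_def sum_2)
  moreover have "Ad (adjoint_mat A) (?Y (\<tau> x0)) = y"
    using y FS A by (metis Ad_adjoint_Ad Ad_mult axis_field_eq monodromy_def)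
  ultimately have "Z x0 = 0" by (simp add: Z_def)
  then have "c = 0" using c[of x0] by simp
  then have "Z x = 0" using c[of x] by simp
  then show ?thesis unfolding Z_def using Ad_Ad_adjoint[OF A] by (metis eq_iff_diff_eq_0)
qed

text \<open>Smoothness is obtained by bootstrapping in the differential equation of the axis field: its right-hand side is as
regular as the field.\<close>

lemma axis_field_in_tangent_space:
  assumes \<tau>: "translation \<tau>" and A: "A \<in> SU2" and \<gamma>: "\<gamma> \<in> curves \<tau> A a"
    and F: "is_frame x0 \<gamma> l F" and y: "Ad (monodromy \<tau> x0 A F) y = y"
  shows "axis_field F y \<in> tangent_space \<tau> A"
proof -
  note dY = axis_field_ode[OF \<gamma> F, of y]
  have "Ck_on k UNIV (axis_field F y)" for k
  proof (induction k)
    case 0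
    show ?case using dY by (auto intro!: continuous_at_imp_continuous_on has_vector_derivative_continuous)
  next
    case (Suc k)
    show ?case
      by (rule Ck_on_UNIV_SucI[OF dY])
        (intro Ck_on_UNIV_linear[OF bounded_linear_scaleR_right] Ck_on_UNIV_bilinear[OF bounded_bilinear_cross3]
          Suc.IH curve_derivative(2)[OF \<gamma>])
  qed
  then show ?thesis
    using axis_field_equivariant[OF assms] by (simp add: tangent_space_def smooth_on_def)
qed

section \<open>The monodromy angle\<close>

lemma axis_fixed:
  assumes "is_rotation_angle B y \<phi>" "norm y = 1"
  shows "Ad B y = y"
proof -
  have "y \<bullet> y = 1" using assms(2) by (simp add: norm_eq_1)
  then have "rotation y \<phi> y = cos \<phi> *\<^sub>R y + (1 - cos \<phi>) *\<^sub>R y" by (simp add: rotation_def)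
  then show ?thesis
    using assms(1) by (simp add: is_rotation_angle_def scaleR_add_left[symmetric])
qed

lemma MW_integrand:
  assumes "\<gamma> \<in> curves \<tau> A a"
  shows "det (vector [unit_tangent \<gamma> x, v, w] :: real^3^3) * speed \<gamma> x
    = vector_derivative \<gamma> (at x) \<bullet> cross3 v w"
  unfolding dot_cross_det[symmetric] curve_derivative(4)[OF assms, symmetric]
  by (simp add: mult.commute)

lemma MW_form_eq:
  assumes "\<gamma> \<in> curves \<tau> A a"
  shows "MW_form \<tau> x0 \<gamma> \<xi> \<eta> = integral {x0..\<tau> x0} (\<lambda>x. vector_derivative \<gamma> (at x) \<bullet> cross3 (\<xi> x) (\<eta> x))"
  unfolding MW_form_def MW_integrand[OF assms] ..

lemma MW_form_linear:
  assumes \<gamma>: "\<gamma> \<in> curves \<tau> A a"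
    and \<xi>: "\<xi> \<in> tangent_space \<tau> A" and \<eta>: "\<eta> \<in> tangent_space \<tau> A" and \<zeta>: "\<zeta> \<in> tangent_space \<tau> A"
  shows "MW_form \<tau> x0 \<gamma> \<xi> (\<lambda>x. r *\<^sub>R \<eta> x + s *\<^sub>R \<zeta> x)
    = r * MW_form \<tau> x0 \<gamma> \<xi> \<eta> + s * MW_form \<tau> x0 \<gamma> \<xi> \<zeta>"
proof -
  let ?f = "\<lambda>\<eta> x. vector_derivative \<gamma> (at x) \<bullet> cross3 (\<xi> x) (\<eta> x)"
  have cont: "continuous_on UNIV \<eta>" if "\<eta> \<in> tangent_space \<tau> A" for \<eta>
  proof -
    have "Ck_on 0 UNIV \<eta>" using that unfolding tangent_space_def smooth_on_def by blast
    then show ?thesis by simp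
  qed
  have int: "?f \<eta> integrable_on {x0..\<tau> x0}" if "\<eta> \<in> tangent_space \<tau> A" for \<eta>
    using Ck_on_UNIV_continuous[OF curve_derivative(2)[OF \<gamma>, of 0]] cont[OF \<xi>] cont[OF that]
    by (intro integrable_continuous_real continuous_on_inner cross.continuous_on)
      (auto intro: continuous_on_subset)
  have "integral {x0..\<tau> x0} (?f (\<lambda>x. r *\<^sub>R \<eta> x + s *\<^sub>R \<zeta> x))
      = integral {x0..\<tau> x0} (\<lambda>x. r *\<^sub>R ?f \<eta> x + s *\<^sub>R ?f \<zeta> x)"
    by (simp add: cross.add_right cross.scaleR_right inner_add_right)
  also have "\<dots> = r *\<^sub>R integral {x0..\<tau> x0} (?f \<eta>) + s *\<^sub>R integral {x0..\<tau> x0} (?f \<zeta>)"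
    by (simp only: integral_cmul
        integral_add[OF integrable_cmul[OF int[OF \<eta>]] integrable_cmul[OF int[OF \<zeta>]]])
  finally show ?thesis by (simp add: MW_form_eq[OF \<gamma>])
qed

text \<open>The infinitesimal rotation \<open>z\<close> of the monodromy is paired with the axis \<open>y\<close>. Its boundary terms cancel: at \<open>\<tau> x0\<close>
the velocity is carried to \<open>Ad B\<close> of its value at \<open>x0\<close>, and \<open>B\<close> fixes \<open>y\<close>. In the integral, moving \<open>Ad F\<close> to the
other side turns \<open>y\<close> into the axis field, and the triple product becomes the integrand of the Marsden--Weinstein form.\<close>

lemma monodromy_angle_derivative:
  fixes F :: "curve \<Rightarrow> real \<Rightarrow> complex^2^2" and Y\<^sub>0 :: "curve \<Rightarrow> real^3"
  assumes \<tau>: "translation \<tau>" and A: "A \<in> SU2"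
    and frame: "\<And>\<gamma>. \<gamma> \<in> curves \<tau> A a \<Longrightarrow> is_frame x0 \<gamma> l (F \<gamma>)"
    and unit: "\<And>\<gamma>. \<gamma> \<in> curves \<tau> A a \<Longrightarrow> norm (Y\<^sub>0 \<gamma>) = 1"
    and angle: "\<And>\<gamma>. \<gamma> \<in> curves \<tau> A a \<Longrightarrow> is_rotation_angle (monodromy \<tau> x0 A (F \<gamma>)) (Y\<^sub>0 \<gamma>) (\<theta> \<gamma>)"
    and var: "variation \<tau> A a \<gamma> g" and cont: "isCont (\<lambda>t. Y\<^sub>0 (g t)) 0"
  shows "has_derivative_mod (2 * pi) (\<lambda>t. \<theta> (g t))
    (l\<^sup>2 * MW_form \<tau> x0 \<gamma> (axis_field (F \<gamma>) (Y\<^sub>0 \<gamma>)) (velocity g))"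
proof -
  have g0: "g 0 = \<gamma>" using var by (simp add: variation_def)
  note in_curves = variation_in_curves[OF var A]
  have \<gamma>: "\<gamma> \<in> curves \<tau> A a" using eventually_nhds_x_imp_x[OF in_curves] g0 by simp
  define b where "b = \<tau> x0"
  define \<gamma>' where "\<gamma>' t y = vector_derivative (g t) (at y)" for t y
  define B where "B t = monodromy \<tau> x0 A (F (g t))" for t
  define y where "y = Y\<^sub>0 \<gamma>"
  define w where "w x = Ad (F \<gamma> x) (cross3 (\<gamma>' 0 x) (velocity g x))" for x
  define z where "z = l *\<^sub>R (Ad (F \<gamma> b) (velocity g b) - velocity g x0) - l\<^sup>2 *\<^sub>R integral {x0..b} w"
  note FS = frame_ode(1)[OF \<gamma> frame[OF \<gamma>]]
  have c': "continuous_on {x0..b} (\<gamma>' 0)"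
    using Ck_on_UNIV_continuous[OF curve_derivative(2)[OF \<gamma>, of 0]]
    by (auto simp: \<gamma>'_def[abs_def] g0 intro: continuous_on_subset)
  have dF: "((\<lambda>t. (F (g t) b ** adjoint_mat (F (g 0) b) - mat 1) /\<^sub>R t) \<longlongrightarrow> su2 z) (at 0)"
    unfolding z_def w_def[abs_def] g0[symmetric]
  proof (rule frame_derivative)
    show "x0 \<le> b" using \<tau> by (simp add: b_def translation_def less_imp_le)
    show "\<forall>\<^sub>F t in nhds 0. F (g t) x0 = mat 1 \<and> (\<forall>y\<in>{x0..b}. F (g t) y \<in> SU2 \<and>
      (F (g t) has_vector_derivative F (g t) y ** su2 (l *\<^sub>R \<gamma>' t y)) (at y within {x0..b}) \<and>
      (g t has_vector_derivative \<gamma>' t y) (at y within {x0..b}))"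
      using in_curves
    proof eventually_elim
      case (elim t)
      then show ?case
        using frame[OF elim] frame_ode[OF elim frame[OF elim]] curve_derivative(1)[OF elim]
        by (auto simp: is_frame_def \<gamma>'_def intro: has_vector_derivative_at_within)
    qed
    show "continuous_on {x0..b} (\<gamma>' 0)" by (rule c')
    show "continuous_on {x0..b} (velocity g)" by (rule continuous_velocity[OF var A])
    show "uniform_limit {x0..b} \<gamma>' (\<gamma>' 0) (at 0)"
      unfolding \<gamma>'_def[abs_def] by (rule variation_tangent[OF var A])
    show "uniform_limit {x0..b} (\<lambda>t y. (g t y - g 0 y) /\<^sub>R t) (velocity g) (at 0)"
      by (rule variation_quotient[OF var A])
  qed
  have B: "B t = F (g t) b ** A" for t by (simp add: B_def monodromy_def b_def)
  have BS: "B 0 \<in> SU2" using FS A by (simp add: B g0 SU2_mult)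
  have dB: "((\<lambda>t. (B t - B 0) /\<^sub>R t) \<longlongrightarrow> su2 z ** B 0) (at 0)"
  proof -
    have "X ** adjoint_mat (F \<gamma> b) ** F \<gamma> b = X" for X :: "complex^2^2"
      by (simp add: matrix_mul_assoc[symmetric] SU2_inv FS)
    then have "(F (g t) b ** adjoint_mat (F (g 0) b) - mat 1) /\<^sub>R t ** B 0 = (B t - B 0) /\<^sub>R t" for t
      by (simp add: matmul.scaleR_left matmul.diff_left B g0 matrix_mul_assoc)
    then show ?thesis using matmul.tendsto[OF dF tendsto_const[of "B 0"]] by simp
  qed
  have "has_derivative_mod (2 * pi) (\<lambda>t. \<theta> (g t)) (z \<bullet> Y\<^sub>0 (g 0))"
  proof (rule angle_derivative[OF _ dB cont])
    show "\<forall>\<^sub>F t in nhds 0. B t \<in> SU2 \<and> norm (Y\<^sub>0 (g t)) = 1 \<and> is_rotation_angle (B t) (Y\<^sub>0 (g t)) (\<theta> (g t))"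
      using in_curves
    proof eventually_elim
      case (elim t)
      then show ?case
        using unit angle frame_ode(1)[OF elim frame[OF elim]] A by (simp add: B SU2_mult) (simp add: B_def monodromy_def b_def)
    qed
  qed
  moreover have "z \<bullet> y = l\<^sup>2 * MW_form \<tau> x0 \<gamma> (axis_field (F \<gamma>) y) (velocity g)"
  proof -
    have "Ad (B 0) y = y"
      using axis_fixed[OF angle[OF \<gamma>] unit[OF \<gamma>]] by (simp add: B_def g0 y_def)
    then have "Ad (adjoint_mat (B 0)) y = y" using Ad_adjoint_Ad[OF BS] by metis
    moreover have "Ad (F \<gamma> b) (velocity g b) = Ad (B 0) (velocity g x0)"
      using velocity_equivariant[OF var A, of x0] FS A by (simp add: B g0 Ad_mult b_def)
    ultimately have boundary: "Ad (F \<gamma> b) (velocity g b) \<bullet> y = velocity g x0 \<bullet> y"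
      by (simp add: inner_Ad[OF BS])
    have "w integrable_on {x0..b}"
      unfolding w_def
      by (intro integrable_continuous_real continuous_on_Ad cross.continuous_on c' continuous_velocity[OF var A] FS
          continuous_on_vector_derivative[where f'="\<lambda>y. F \<gamma> y ** su2 (l *\<^sub>R vector_derivative \<gamma> (at y))"]
          has_vector_derivative_at_within[OF frame_ode(2)[OF \<gamma> frame[OF \<gamma>]]])
    then have "integral {x0..b} w \<bullet> y = integral {x0..b} (\<lambda>x. w x \<bullet> y)"
      using integral_linear[of w "{x0..b}" "\<lambda>v. v \<bullet> y"] by (simp add: o_def bounded_linear_inner_left)
    also have "\<dots> = integral {x0..b} (\<lambda>x. - (vector_derivative \<gamma> (at x) \<bullet> cross3 (axis_field (F \<gamma>) y x) (velocity g x)))"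
    proof (intro integral_cong)
      fix x
      have "w x \<bullet> y = cross3 (vector_derivative \<gamma> (at x)) (velocity g x) \<bullet> axis_field (F \<gamma>) y x"
        by (simp add: w_def \<gamma>'_def g0 inner_Ad[OF FS] axis_field_eq[OF FS])
      also have "\<dots> = - (vector_derivative \<gamma> (at x) \<bullet> cross3 (axis_field (F \<gamma>) y x) (velocity g x))"
        by (simp add: cross3_simps)
      finally show "w x \<bullet> y = - (vector_derivative \<gamma> (at x) \<bullet> cross3 (axis_field (F \<gamma>) y x) (velocity g x))" .
    qed
    also have "\<dots> = - MW_form \<tau> x0 \<gamma> (axis_field (F \<gamma>) y) (velocity g)"
      by (simp add: MW_form_eq[OF \<gamma>] b_def)
    finally show ?thesis
      by (simp add: z_def inner_diff_left boundary)
  qed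
  ultimately show ?thesis by (simp add: g0 y_def)
qed

lemma has_derivative_mod_scale:
  assumes "has_derivative_mod p f c"
  shows "has_derivative_mod (r * p) (\<lambda>t. r * f t) (r * c)"
proof -
  obtain \<phi> where \<phi>: "(\<phi> has_real_derivative c) (at 0)"
    and eq: "\<forall>\<^sub>F t in nhds 0. \<exists>k::int. f t = \<phi> t + of_int k * p"
    using assms unfolding has_derivative_mod_def by blast
  have "\<forall>\<^sub>F t in nhds 0. \<exists>k::int. r * f t = r * \<phi> t + of_int k * (r * p)"
    using eq by eventually_elim (auto simp: algebra_simps)
  with DERIV_cmult[OF \<phi>] show ?thesis unfolding has_derivative_mod_def by blast
qed

theorem theorem12:
  fixes \<tau> :: "real \<Rightarrow> real" and x0 lam :: real
    and A :: "complex^2^2" and a :: "real^3"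
    and F :: "curve \<Rightarrow> real \<Rightarrow> real \<Rightarrow> complex^2^2"
    and Y0 :: "curve \<Rightarrow> real \<Rightarrow> real^3"
    and \<theta> :: "curve \<Rightarrow> real"
  assumes "translation \<tau>" and "A \<in> SU2" and "lam \<noteq> 0"
    and frame: "\<And>\<gamma> l. \<gamma> \<in> curves \<tau> A a \<Longrightarrow> is_frame x0 \<gamma> l (F \<gamma> l)"
    and axis: "\<And>\<gamma>. \<gamma> \<in> curves \<tau> A a \<Longrightarrow>
      axis_family (\<lambda>l. monodromy \<tau> x0 A (F \<gamma> l)) (Y0 \<gamma>)"
    and axis_consistent: "\<And>\<gamma> g. \<gamma> \<in> regular_curves \<tau> x0 A a (\<lambda>\<gamma>. F \<gamma> lam) \<Longrightarrow>
      variation \<tau> A a \<gamma> g \<Longrightarrow> isCont (\<lambda>t. Y0 (g t) lam) 0"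
    and angle: "\<And>\<gamma>. \<gamma> \<in> curves \<tau> A a \<Longrightarrow>
      is_rotation_angle (monodromy \<tau> x0 A (F \<gamma> lam)) (Y0 \<gamma> lam) (\<theta> \<gamma>)"
  shows "(\<forall>\<gamma> \<in> regular_curves \<tau> x0 A a (\<lambda>\<gamma>. F \<gamma> lam).
           \<exists>d\<theta>. has_differential_mod (2 * pi) \<tau> A a \<theta> \<gamma> d\<theta> \<and>
             (\<forall>g. variation \<tau> A a \<gamma> g \<longrightarrow>
               (\<exists>\<theta>'. has_derivative_mod (2 * pi) (\<lambda>t. \<theta> (g t)) \<theta>' \<and>
                 1 / lam\<^sup>2 * \<theta>' = 1 / lam\<^sup>2 * d\<theta> (velocity g) \<and>
                 1 / lam\<^sup>2 * d\<theta> (velocity g) =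
                   MW_form \<tau> x0 \<gamma> (axis_field (F \<gamma> lam) (Y0 \<gamma> lam)) (velocity g))))
       \<and> (\<forall>\<gamma> g. variation \<tau> A a \<gamma> g \<longrightarrow> isCont (\<lambda>t. Y0 (g t) lam) 0 \<longrightarrow>
             (\<exists>\<theta>'. has_derivative_mod (2 * pi) (\<lambda>t. \<theta> (g t)) \<theta>' \<and>
               1 / lam\<^sup>2 * \<theta>' =
                 MW_form \<tau> x0 \<gamma> (axis_field (F \<gamma> lam) (Y0 \<gamma> lam)) (velocity g)))
       \<and> symplectic_field_mod (2 * pi / lam\<^sup>2) \<tau> x0 A a
           (regular_curves \<tau> x0 A a (\<lambda>\<gamma>. F \<gamma> lam))
           (\<lambda>\<gamma>. 1 / lam\<^sup>2 * \<theta> \<gamma>) (\<lambda>\<gamma>. axis_field (F \<gamma> lam) (Y0 \<gamma> lam))"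
proof -
  let ?R = "regular_curves \<tau> x0 A a (\<lambda>\<gamma>. F \<gamma> lam)"
  define Y where "Y \<gamma> = axis_field (F \<gamma> lam) (Y0 \<gamma> lam)" for \<gamma>
  have unit: "norm (Y0 \<gamma> lam) = 1" if "\<gamma> \<in> curves \<tau> A a" for \<gamma>
    using axis[OF that] by (simp add: axis_family_def)
  have deriv: "has_derivative_mod (2 * pi) (\<lambda>t. \<theta> (g t)) (lam\<^sup>2 * MW_form \<tau> x0 \<gamma> (Y \<gamma>) (velocity g))"
    if "variation \<tau> A a \<gamma> g" "isCont (\<lambda>t. Y0 (g t) lam) 0" for \<gamma> g
    unfolding Y_def
    by (rule monodromy_angle_derivative[where Y\<^sub>0="\<lambda>\<gamma>. Y0 \<gamma> lam" and F="\<lambda>\<gamma>. F \<gamma> lam"])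
      (use assms(1,2) frame unit angle that in auto)
  have tangent: "Y \<gamma> \<in> tangent_space \<tau> A" if "\<gamma> \<in> curves \<tau> A a" for \<gamma>
    unfolding Y_def
    by (rule axis_field_in_tangent_space[OF assms(1,2) that frame[OF that] axis_fixed[OF angle[OF that] unit[OF that]]])
  have curve: "\<gamma> \<in> curves \<tau> A a" if "\<gamma> \<in> ?R" for \<gamma>
    using that by (simp add: regular_curves_def)
  have deriv': "has_derivative_mod (2 * pi) (\<lambda>t. \<theta> (g t)) (lam\<^sup>2 * MW_form \<tau> x0 \<gamma> (Y \<gamma>) (velocity g))"
    if "\<gamma> \<in> ?R" "variation \<tau> A a \<gamma> g" for \<gamma> g
    using deriv axis_consistent that by blast
  have "has_differential_mod (2 * pi) \<tau> A a \<theta> \<gamma> (\<lambda>\<xi>. lam\<^sup>2 * MW_form \<tau> x0 \<gamma> (Y \<gamma>) \<xi>)" if "\<gamma> \<in> ?R" for \<gamma>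
    unfolding has_differential_mod_def
    using deriv'[OF that] MW_form_linear[OF curve[OF that] tangent[OF curve[OF that]]]
    by (simp add: algebra_simps)
  moreover have "has_differential_mod (2 * pi / lam\<^sup>2) \<tau> A a (\<lambda>\<gamma>. 1 / lam\<^sup>2 * \<theta> \<gamma>) \<gamma> (MW_form \<tau> x0 \<gamma> (Y \<gamma>))"
    if "\<gamma> \<in> ?R" for \<gamma>
    unfolding has_differential_mod_def
    using has_derivative_mod_scale[OF deriv'[OF that], where r="1 / lam\<^sup>2"] \<open>lam \<noteq> 0\<close>
      MW_form_linear[OF curve[OF that] tangent[OF curve[OF that]]]
    by simp
  moreover have "1 / lam\<^sup>2 * (lam\<^sup>2 * c) = c" for c using \<open>lam \<noteq> 0\<close> by simp
  ultimately show ?thesis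
    unfolding symplectic_field_mod_def Y_def[symmetric]
    using deriv deriv' tangent curve by metis
qed

end
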